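(* For every ordinal $\xi$, every $p\in\{1,\infty\}$, and every $i\in\{1,2,3,4\}$, $P^\vee_i(\omega^\xi,p)=P^\wedge_i(\omega^\xi,p)$.
   Context: Trees: a tree is a set of finite sequences (including $\varnothing$) closed under initial segments. $T'$ is $T$ with its maximal members removed, $d^0(T)=T$, $d^{\xi+1}(T)=(d^\xi(T))'$, $d^\xi(T)=\bigcap_{\zeta<\xi}d^\zeta(T)$ for limit $\xi$, $o(T)=\min\{\xi:d^\xi(T)=\varnothing\}$, with $o(T)=\infty$ if no such ordinal exists; $\xi<\infty$ for all ordinals $\xi$. An FDD for $X$ is a sequence $E=(E_n)$ of finite dimensional subspaces so that each $x\in X$ is uniquely $x=\sum x_n$ with $x_n\in E_n$; $P^E_nx=x_n$, $\mathrm{supp}_E(x)=\{n:P^E_nx\neq0\}$. $\Sigma(E,X)$ is the set of finite block sequences: finite sequences of non-zero, finitely supported vectors with $\max\mathrm{supp}_E(x_i)<\min\mathrm{supp}_E(x_{i+1})$. $T_p(X,K)$ is the tree of all finite sequences $(x_i)_{i=1}^n$ in the unit ball $B_X$ with $K^{-1}\leqslant\|\sum_{i=1}^na_ix_i\|\leqslant1$ for all $(a_i)_{i=1}^n$ in the unit sphere of $\ell_p^n$; $T_p(X,E,K)=T_p(X,K)\cap\Sigma(E,X)$. For a tree $T$ of sequences in $X$, $d_E(T)$ is the set of $(x_i)_{i=1}^n\in T$ for which there exist $(y_i)_{i\in\mathbb{N}}$ with $i\leqslant\min\mathrm{supp}_E(y_i)$ and $(x_1,\ldots,x_n,y_i)\in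 T$ for all $i$; $d^\xi_E$ is its transfinite iteration (intersections at limits), $o_E(T)=\min\{\xi:d^\xi_E(T)=\varnothing\}$ (or $\infty$). $I_p(X,K)=o(T_p(X,K))$, $I_p(X,E,K)=o(T_p(X,E,K))$, $I^a_p(X,E,K)=o_E(T_p(X,E,K))$. Schreier families: for families $\mathcal{F},\mathcal{G}$ of finite subsets of $\mathbb{N}$, $\mathcal{F}[\mathcal{G}]$ consists of $\varnothing$ and all unions $\bigcup_{i=1}^sE_i$ with non-empty $E_i\in\mathcal{G}$, $\max E_i<\min E_{i+1}$, $\{\min E_i\}_{i=1}^s\in\mathcal{F}$. $\mathcal{S}_0=\{E:|E|\leqslant1\}$, $\mathcal{S}=\mathcal{S}_1=\{\varnothing\}\cup\{E:|E|\leqslant\min E\}$, $\mathcal{S}_{\xi+1}=\mathcal{S}[\mathcal{S}_\xi]$; for limit $\xi<\omega_1$, $\mathcal{S}_\xi=\{E:\exists n\leqslant\min E,\ E\in\mathcal{S}_{\xi_n+1}\}$ for a fixed sequence $\xi_n\uparrow\xi$ with $\mathcal{S}_{\xi_n+1}\subset\mathcal{S}_{\xi_{n+1}}$; $\mathcal{S}_{\omega_1}$ is the family of all finite subsets of $\mathbb{N}$. An infinite sequence $(x_n)\subset X$ is a $K$-$\ell_p^\xi$ spreading model ($K$-$c_0^\xi$ spreading model if $p=\infty$) if $(x_n)_{n\in E}\in T_p(X,K)$ for each $E\in\mathcal{S}_\xi$. $\mathcal{SM}_p(X,K)=\min\{\xi\leqslant\omega_1:X\text{ admits no }K\text{-}\ell_p^\xi\text{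 spreading model}\}$ (with $c_0$ in place of $\ell_p$ when $p=\infty$), $=\infty$ if there is no such $\xi$. Classes: $P^\vee_1(\xi,p)$ (resp. $P^\wedge_1(\xi,p)$) is the class of Banach spaces $X$ with $I_p(X,K)>\omega^\xi$ for some (resp. all) $K>1$. $P^\vee_2(\xi,p)$ (resp. $P^\wedge_2(\xi,p)$) is the class of pairs $(E,X)$, $E$ an FDD for the (separable) Banach space $X$, with $I_p(X,E,K)>\omega^\xi$ for some (resp. all) $K>1$. $P^\vee_3(\xi,p)$ and $P^\wedge_3(\xi,p)$ are defined in the same way with $I^a_p(X,E,K)$ in place of $I_p(X,E,K)$. $P^\vee_4(\xi,p)$ (resp. $P^\wedge_4(\xi,p)$) is the class of Banach spaces $X$ with $\mathcal{SM}_p(X,K)>\xi$ for some (resp. all) $K>1$. *)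

theory Defs
  imports "HOL-Analysis.Analysis" "HOL-Library.Sublist" "HOL-Library.Extended"
begin

no_notation Pinf (\<open>\<infinity>\<close>)
no_notation Minf (\<open>-\<infinity>\<close>)
no_notation elt_set_eq (infix \<open>=o\<close> 50)
unbundle cardinal_syntax

section \<open>Ordinals\<close>

text \<open>
  HOL has no type of all ordinals. The type \<open>'u ordinal\<close> consists of the order types of the
  well-orders on subsets of \<open>'u + real\<close>, i.e. of all ordinals of cardinality at most
  \<open>|'u + real|\<close>. A statement about all \<open>\<xi> :: 'u ordinal\<close> with \<open>'u\<close> a free type variable is
  therefore a statement about all ordinals. The summand \<open>real\<close> makes \<open>'u + real\<close> uncountable, so
  \<open>\<omega>\<close> and \<open>\<omega>\<^sub>1\<close> belong to every \<open>'u ordinal\<close>. By \<open>ordinal_small_bounded\<close> below, the type has no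
  largest element and is closed under suprema indexed by its initial segments, hence under the
  ordinal operations.
\<close>

quotient_type 'u ordinal = "('u + real) rel" / partial: "\<lambda>r s. r =o s"
proof (rule part_equivpI)
  show "\<exists>r :: ('u + real) rel. r =o r"
    using card_of_refl by blast
qed (auto simp: symp_def transp_def intro: ordIso_symmetric ordIso_transitive)

lemma Well_order_rep_ordinal: "Well_order (rep_ordinal \<alpha>)"
  using Quotient3_ordinal[THEN Quotient3_rep_reflp, of \<alpha>] by (simp add: ordIso_def)

lemma abs_ordinal_cases:
  obtains r where "Well_order r" "\<alpha> = abs_ordinal r"
  using Well_order_rep_ordinal[of \<alpha>] Quotient3_ordinal[THEN Quotient3_abs_rep, of \<alpha>] by metis

instantiation ordinal :: (type) wellorder
begin

lift_definition less_eq_ordinal :: "'a ordinal \<Rightarrow> 'a ordinal \<Rightarrow> bool" is "\<lambda>r s. r \<le>o s"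
  by (meson ordIso_ordLeq_trans ordIso_symmetric ordLeq_ordIso_trans)

lift_definition less_ordinal :: "'a ordinal \<Rightarrow> 'a ordinal \<Rightarrow> bool" is "\<lambda>r s. r <o s"
  by (meson ordIso_ordLess_trans ordIso_symmetric ordLess_ordIso_trans)

instance
proof
  fix \<alpha> \<beta> \<gamma> :: "'a ordinal" and P :: "'a ordinal \<Rightarrow> bool"
  show "(\<alpha> < \<beta>) = (\<alpha> \<le> \<beta> \<and> \<not> \<beta> \<le> \<alpha>)"
    by transfer (auto simp: ordIso_def not_ordLeq_iff_ordLess intro: ordLess_imp_ordLeq)
  show "\<alpha> \<le> \<alpha>" by transfer (simp add: ordIso_iff_ordLeq)
  show "\<alpha> \<le> \<gamma>" if "\<alpha> \<le> \<beta>" "\<beta> \<le> \<gamma>" using that by transfer (rule ordLeq_transitive)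
  show "\<alpha> = \<beta>" if "\<alpha> \<le> \<beta>" "\<beta> \<le> \<alpha>" using that by transfer (simp add: ordIso_iff_ordLeq)
  show "\<alpha> \<le> \<beta> \<or> \<beta> \<le> \<alpha>" by transfer (simp add: ordIso_def ordLeq_total)
  show "P \<alpha>" if *: "\<And>\<alpha>. (\<And>\<beta>. \<beta> < \<alpha> \<Longrightarrow> P \<beta>) \<Longrightarrow> P \<alpha>"
  proof -
    have "P (abs_ordinal r)" if "Well_order r" for r :: "('a + real) rel"
      using that
    proof (induction r rule: wf_induct_rule[OF wf_ordLess])
      case (1 r)
      show ?case
      proof (rule *)
        fix \<beta> assume "\<beta> < abs_ordinal r"
        moreover obtain s where s: "Well_order s" "\<beta> = abs_ordinal s" by (rule abs_ordinal_cases)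
        ultimately have "s <o r"
          using "1.prems" by (simp add: less_ordinal.abs_eq ordIso_reflexive)
        then show "P \<beta>" using 1 s by simp
      qed
    qed
    then show ?thesis by (metis abs_ordinal_cases)
  qed
qed

end

lemma abs_ordinal_less:
  "Well_order r \<Longrightarrow> Well_order s \<Longrightarrow> abs_ordinal r < abs_ordinal s \<longleftrightarrow> r <o s"
  by (simp add: less_ordinal.abs_eq ordIso_reflexive)

lemma abs_ordinal_eq:
  "Well_order r \<Longrightarrow> Well_order s \<Longrightarrow> abs_ordinal r = abs_ordinal s \<longleftrightarrow> r =o s"
  using Quotient3_ordinal[THEN Quotient3_rel, of r s] by (simp add: ordIso_reflexive)

lemma abs_ordinal_initial_segment:
  assumes r: "Well_order r"
  shows "bij_betw (\<lambda>a. abs_ordinal (Restr r (underS r a))) (Field r) {..<abs_ordinal r}"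
proof -
  have wo: "Well_order (Restr r A)" for A using r by (rule Well_order_Restr)
  have lt: "Restr r (underS r a) <o Restr r (underS r b)"
    if "a \<in> Field r" "b \<in> Field r" "(a, b) \<in> r" "a \<noteq> b" for a b
  proof -
    have "wo_rel r" using r by (simp add: wo_rel_def)
    have "underS r a \<subseteq> underS r b"
      using that(3) r by (intro underS_incr) (auto simp: order_on_defs)
    moreover have "a \<in> underS r b" using that by (simp add: underS_def)
    ultimately have "underS r a \<subset> underS r b" using underS_notIn[of a r] by blast
    then show ?thesis
      using ofilter_subset_ordLess[OF r] wo_rel.underS_ofilter[OF \<open>wo_rel r\<close>] by blast
  qed
  show ?thesis
    unfolding bij_betw_def
  proof
    show "inj_on (\<lambda>a. abs_ordinal (Restr r (underS r a))) (Field r)"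
    proof (rule inj_onI, rule ccontr)
      fix a b assume ab: "a \<in> Field r" "b \<in> Field r" "a \<noteq> b"
        and eq: "abs_ordinal (Restr r (underS r a)) = abs_ordinal (Restr r (underS r b))"
      then have "(a, b) \<in> r \<or> (b, a) \<in> r"
        using r by (auto simp: well_order_on_def linear_order_on_def total_on_def)
      then show False
        using lt[of a b] lt[of b a] ab eq abs_ordinal_less[OF wo wo]
        by (metis less_irrefl)
    qed
    show "(\<lambda>a. abs_ordinal (Restr r (underS r a))) ` Field r = {..<abs_ordinal r}"
    proof (intro equalityI subsetI)
      fix \<beta> assume "\<beta> \<in> (\<lambda>a. abs_ordinal (Restr r (underS r a))) ` Field r"
      then show "\<beta> \<in> {..<abs_ordinal r}"
        using underS_Restr_ordLess[OF r] abs_ordinal_less[OF wo r] by fastforce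
    next
      fix \<beta> assume "\<beta> \<in> {..<abs_ordinal r}"
      moreover obtain s where s: "Well_order s" "\<beta> = abs_ordinal s" by (rule abs_ordinal_cases)
      ultimately have "s <o r" using abs_ordinal_less r by auto
      then obtain a where "a \<in> Field r" "s =o Restr r (underS r a)"
        using ordLess_iff_ordIso_Restr[OF r s(1)] by blast
      then show "\<beta> \<in> (\<lambda>a. abs_ordinal (Restr r (underS r a))) ` Field r"
        using s abs_ordinal_eq[OF s(1) wo] by blast
    qed
  qed
qed

lemma card_of_initial_segment: "|{..<\<alpha> :: 'u ordinal}| \<le>o |UNIV :: ('u + real) set|"
proof -
  obtain r where r: "Well_order r" "\<alpha> = abs_ordinal r" by (rule abs_ordinal_cases)
  have "|{..<\<alpha>}| =o |Field r|"
    using abs_ordinal_initial_segment[OF r(1)] r(2) card_of_ordIso ordIso_symmetric by blast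
  then show ?thesis using ordIso_ordLeq_trans card_of_mono1[of "Field r" UNIV] by blast
qed

lemma card_of_ordinals: "\<not> |UNIV :: 'u ordinal set| \<le>o |UNIV :: ('u + real) set|"
proof
  assume "|UNIV :: 'u ordinal set| \<le>o |UNIV :: ('u + real) set|"
  then obtain f :: "'u ordinal \<Rightarrow> 'u + real" where f: "inj f"
    unfolding card_of_ordLeq[symmetric] by auto
  define r where "r = {(f a, f b) | a b. a \<le> b}"
  have r_iff: "(f a, f b) \<in> r \<longleftrightarrow> a \<le> b" for a b
    using f by (auto simp: r_def inj_eq)
  have r_sub: "r \<subseteq> range f \<times> range f" by (auto simp: r_def)
  have "f a \<in> Field r" for a using r_iff[of a a] by (auto intro: FieldI1)
  then have Field: "Field r = range f"
    using r_sub by (auto simp: Field_def)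
  have "r - Id \<subseteq> inv_image {(a, b). a < b} (inv f)"
    using f by (auto simp: r_def less_le)
  then have wf: "wf (r - Id)"
    by (rule wf_subset[OF wf_inv_image[OF wf]])
  have r: "Well_order r"
    unfolding order_on_defs well_order_on_def
  proof (intro conjI)
    show "refl_on (Field r) r" unfolding refl_on_def Field by (auto simp: r_iff)
    show "trans r" by (rule transI) (use f in \<open>auto simp: r_def inj_eq\<close>)
    show "antisym r" by (rule antisymI) (use f in \<open>auto simp: r_def inj_eq\<close>)
    show "total_on (Field r) r" unfolding total_on_def Field by (auto simp: r_iff)
  qed (use r_sub wf in \<open>auto simp: Field\<close>)
  have wo: "Well_order (Restr r A)" for A using r by (rule Well_order_Restr)
  define h where "h a = abs_ordinal (Restr r (underS r (f a)))" for a
  have less: "h a < abs_ordinal r" for a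
    using bij_betwE[OF abs_ordinal_initial_segment[OF r]] unfolding h_def Field by auto
  have mono: "h a < h b" if "a < b" for a b
  proof -
    have "underS r (f a) \<subseteq> underS r (f b)"
      using that r by (intro underS_incr) (auto simp: order_on_defs r_iff)
    moreover have "f a \<in> underS r (f b)"
      using that f by (auto simp: underS_def r_iff inj_eq)
    ultimately have "underS r (f a) \<subset> underS r (f b)" using underS_notIn[of "f a" r] by blast
    then have "Restr r (underS r (f a)) <o Restr r (underS r (f b))"
      using ofilter_subset_ordLess[OF r] wo_rel.underS_ofilter[of r] r by (simp add: wo_rel_def)
    then show ?thesis using abs_ordinal_less[OF wo wo] by (simp add: h_def)
  qed
  have "a \<le> h a" for a
  proof (induction a rule: less_induct)
    case (less a)
    show ?case
    proof (rule ccontr)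
      assume "\<not> a \<le> h a"
      then have "h a < a" by simp
      then show False using less[of "h a"] mono[of "h a" a] by simp
    qed
  qed
  then show False using less[of "abs_ordinal r"] by (simp add: leD)
qed

lemma ordinal_small_bounded:
  fixes A :: "'u ordinal set"
  assumes "|A| \<le>o |UNIV :: ('u + real) set|"
  shows "\<exists>\<alpha>. \<forall>\<beta>\<in>A. \<beta> < \<alpha>"
proof (rule ccontr)
  assume *: "\<nexists>\<alpha>. \<forall>\<beta>\<in>A. \<beta> < \<alpha>"
  have "x \<in> A \<union> (\<Union>\<beta>\<in>A. {..<\<beta>})" for x
    using * by (auto simp: not_less le_less)
  then have eq: "A \<union> (\<Union>\<beta>\<in>A. {..<\<beta>}) = UNIV" by (intro UNIV_eq_I[symmetric])
  have inf: "infinite (UNIV :: ('u + real) set)"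
    using infinite_UNIV_char_0[where 'a = real] by simp
  have "|A \<union> (\<Union>\<beta>\<in>A. {..<\<beta>})| \<le>o |UNIV :: ('u + real) set|"
    using assms inf card_of_initial_segment
    by (intro card_of_Un_ordLeq_infinite_Field card_of_UNION_ordLeq_infinite)
      (auto simp: Field_card_of card_of_card_order_on)
  then show False using card_of_ordinals unfolding eq by (rule notE[rotated])
qed

definition osucc :: "'u ordinal \<Rightarrow> 'u ordinal" where
  "osucc \<alpha> = (LEAST \<beta>. \<alpha> < \<beta>)"

definition osup :: "'u ordinal set \<Rightarrow> 'u ordinal" where
  "osup A = (LEAST \<alpha>. \<forall>\<beta>\<in>A. \<beta> \<le> \<alpha>)"

instantiation ordinal :: (type) "{zero, one}"
begin

definition "0 = osup ({} :: 'a ordinal set)"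
definition "1 = osucc (0 :: 'a ordinal)"

instance ..

end

definition limit_ordinal :: "'u ordinal \<Rightarrow> bool" where
  "limit_ordinal \<alpha> \<longleftrightarrow> \<alpha> \<noteq> 0 \<and> (\<forall>\<beta>. \<alpha> \<noteq> osucc \<beta>)"

text \<open>
  Transfinite recursion with base value \<open>z\<close>, successor step \<open>s\<close> and limit step \<open>l\<close>; the limit
  step may use the earlier values only. See \<open>orec_0\<close>, \<open>orec_osucc\<close>, \<open>orec_limit\<close>.
\<close>

definition orec :: "'b \<Rightarrow> ('b \<Rightarrow> 'b) \<Rightarrow> ('u ordinal \<Rightarrow> ('u ordinal \<Rightarrow> 'b) \<Rightarrow> 'b) \<Rightarrow> 'u ordinal \<Rightarrow> 'b" where
  "orec z s l = wfrec {(\<alpha>, \<beta>). \<alpha> < \<beta>} (\<lambda>f \<alpha>.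
     if \<alpha> = 0 then z
     else if \<exists>\<beta>. \<alpha> = osucc \<beta> then s (f (THE \<beta>. \<alpha> = osucc \<beta>))
     else l \<alpha> f)"

lemma osucc_greater: "\<alpha> < osucc \<alpha>"
proof -
  have "|{\<alpha>}| \<le>o |UNIV :: ('a + real) set|"
    by (rule card_of_singl_ordLeq) simp
  from ordinal_small_bounded[OF this] obtain \<beta> where "\<alpha> < \<beta>" by auto
  then show ?thesis unfolding osucc_def by (rule LeastI)
qed

lemma less_osucc_iff: "\<beta> < osucc \<alpha> \<longleftrightarrow> \<beta> \<le> \<alpha>"
  by (metis leI le_less_trans not_less_Least osucc_def osucc_greater)

lemma osucc_inject [simp]: "osucc \<alpha> = osucc \<beta> \<longleftrightarrow> \<alpha> = \<beta>"
  by (metis less_osucc_iff order_antisym order_refl)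

lemma ordinal_zero_le [simp]: "0 \<le> (\<alpha> :: 'u ordinal)"
  by (simp add: zero_ordinal_def osup_def Least_le)

lemma osucc_neq_0 [simp]: "osucc \<alpha> \<noteq> 0"
  by (metis ordinal_zero_le osucc_greater leD)

lemma osup_least_upper_bound:
  fixes A :: "'u ordinal set"
  assumes "|A| \<le>o |UNIV :: ('u + real) set|"
  shows "osup A \<le> \<alpha> \<longleftrightarrow> (\<forall>\<beta>\<in>A. \<beta> \<le> \<alpha>)"
proof -
  obtain \<gamma> where "\<forall>\<beta>\<in>A. \<beta> \<le> \<gamma>"
    using ordinal_small_bounded[OF assms] by (meson less_imp_le)
  then have "\<forall>\<beta>\<in>A. \<beta> \<le> osup A"
    unfolding osup_def by (rule LeastI)
  moreover have "osup A \<le> \<alpha>" if "\<forall>\<beta>\<in>A. \<beta> \<le> \<alpha>"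
    unfolding osup_def using that by (rule Least_le)
  ultimately show ?thesis by (meson order_trans)
qed

lemma wf_ordinal_less: "wf {(\<alpha> :: 'u ordinal, \<beta>). \<alpha> < \<beta>}"
  by (rule wf)

lemma orec_0: "orec z s l 0 = z"
  by (simp add: orec_def wfrec[OF wf_ordinal_less])

lemma orec_osucc: "orec z s l (osucc \<alpha>) = s (orec z s l \<alpha>)"
  unfolding orec_def by (subst wfrec[OF wf_ordinal_less]) (simp add: cut_apply osucc_greater)

lemma orec_limit:
  assumes "limit_ordinal \<alpha>" and "\<And>f g. (\<And>\<beta>. \<beta> < \<alpha> \<Longrightarrow> f \<beta> = g \<beta>) \<Longrightarrow> l \<alpha> f = l \<alpha> g"
  shows "orec z s l \<alpha> = l \<alpha> (orec z s l)"
proof -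
  have "orec z s l \<alpha> = l \<alpha> (cut (orec z s l) {(\<alpha>, \<beta>). \<alpha> < \<beta>} \<alpha>)"
    using assms(1) unfolding orec_def
    by (subst wfrec[OF wf_ordinal_less]) (auto simp: limit_ordinal_def)
  also have "\<dots> = l \<alpha> (orec z s l)" by (rule assms(2)) (simp add: cut_apply)
  finally show ?thesis .
qed

instantiation ordinal :: (type) "{plus, times}"
begin

definition "\<alpha> + \<beta> = orec \<alpha> osucc (\<lambda>\<gamma> f. osup (f ` {..<\<gamma>})) (\<beta> :: 'a ordinal)"
definition "\<alpha> * \<beta> = orec 0 (\<lambda>\<gamma>. \<gamma> + \<alpha>) (\<lambda>\<gamma> f. osup (f ` {..<\<gamma>})) (\<beta> :: 'a ordinal)"

instance ..

end

definition omega :: "'u ordinal" where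
  "omega = osup (range (\<lambda>n. (osucc ^^ n) 0))"

definition omega_pow :: "'u ordinal \<Rightarrow> 'u ordinal" where
  "omega_pow = orec 1 (\<lambda>\<gamma>. \<gamma> * omega) (\<lambda>\<gamma> f. osup (f ` {..<\<gamma>}))"

definition omega1 :: "'u ordinal" where
  "omega1 = (LEAST \<alpha>. uncountable {..<\<alpha>})"

lemma uncountable_omega1: "uncountable {..<omega1 :: 'u ordinal}"
proof -
  obtain r :: "('u + real) rel" where r: "Well_order r" "Field r = UNIV"
    using well_order_on[of UNIV] well_order_on_Well_order[of UNIV] by blast
  have "uncountable (range (Inr :: real \<Rightarrow> 'u + real))"
    using uncountable_UNIV_real by (simp add: countable_image_inj_eq)
  moreover have "range Inr \<subseteq> Field r" unfolding r(2) by (rule subset_UNIV)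
  ultimately have "uncountable (Field r)" by (blast dest: countable_subset)
  then have "uncountable {..<abs_ordinal r}"
    using abs_ordinal_initial_segment[OF r(1)] countable_image_inj_eq by (auto simp: bij_betw_def)
  then show ?thesis unfolding omega1_def by (rule LeastI)
qed

unbundle no cardinal_syntax

section \<open>Trees and their derivatives\<close>

definition tree_deriv :: "'a list set \<Rightarrow> 'a list set" where
  "tree_deriv T = T - {t\<in>T. \<not> (\<exists>s\<in>T. strict_prefix t s)}"

definition iter_deriv :: "('a set \<Rightarrow> 'a set) \<Rightarrow> 'a set \<Rightarrow> 'u ordinal \<Rightarrow> 'a set" where
  "iter_deriv D T = orec T D (\<lambda>\<xi> f. \<Inter>\<zeta>\<in>{..<\<xi>}. f \<zeta>)"

text \<open>
  The order associated with a derivation; \<open>Pinf\<close> stands for \<open>\<infinity>\<close>. Whether it exceeds a given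
  \<open>\<xi> :: 'u ordinal\<close> does not depend on the choice of \<open>'u\<close>.
\<close>

definition deriv_order :: "('a set \<Rightarrow> 'a set) \<Rightarrow> 'a set \<Rightarrow> 'u ordinal extended" where
  "deriv_order D T =
     (if \<exists>\<xi> :: 'u ordinal. iter_deriv D T \<xi> = {}
      then Fin (LEAST \<xi>. iter_deriv D T \<xi> = {}) else Pinf)"

section \<open>FDDs\<close>

text \<open>
  Throughout \<open>\<nat> = {1, 2, \<dots>}\<close>: the value at \<open>0\<close> of a sequence indexed by \<open>nat\<close> is irrelevant.
\<close>

definition FDD_expansion :: "(nat \<Rightarrow> 'x::real_normed_vector set) \<Rightarrow> (nat \<Rightarrow> 'x) \<Rightarrow> 'x \<Rightarrow> bool" where
  "FDD_expansion E y x \<longleftrightarrow> y 0 = 0 \<and> (\<forall>n\<ge>1. y n \<in> E n) \<and> (\<lambda>n. y (Suc n)) sums x"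

definition FDD :: "(nat \<Rightarrow> 'x::banach set) \<Rightarrow> bool" where
  "FDD E \<longleftrightarrow> (\<forall>n\<ge>1. \<exists>B. finite B \<and> E n = span B) \<and> (\<forall>x. \<exists>!y. FDD_expansion E y x)"

definition FDD_proj :: "(nat \<Rightarrow> 'x::banach set) \<Rightarrow> nat \<Rightarrow> 'x \<Rightarrow> 'x" where
  "FDD_proj E n x = (THE y. FDD_expansion E y x) n"

definition supp :: "(nat \<Rightarrow> 'x::banach set) \<Rightarrow> 'x \<Rightarrow> nat set" where
  "supp E x = {n. n \<ge> 1 \<and> FDD_proj E n x \<noteq> 0}"

definition block_sequences :: "(nat \<Rightarrow> 'x::banach set) \<Rightarrow> 'x list set" where
  "block_sequences E =
     {xs. (\<forall>x\<in>set xs. x \<noteq> 0 \<and> finite (supp E x)) \<and>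
          (\<forall>i. Suc i < length xs \<longrightarrow> Max (supp E (xs ! i)) < Min (supp E (xs ! Suc i)))}"

text \<open>For \<open>supp E (y i) = {}\<close> the condition \<open>i \<le> min supp\<close> is read with \<open>min {} = \<infinity>\<close>.\<close>

definition FDD_deriv :: "(nat \<Rightarrow> 'x::banach set) \<Rightarrow> 'x list set \<Rightarrow> 'x list set" where
  "FDD_deriv E T =
     {xs\<in>T. \<exists>y :: nat \<Rightarrow> 'x. \<forall>i\<ge>1. (\<forall>j\<in>supp E (y i). i \<le> j) \<and> xs @ [y i] \<in> T}"

section \<open>The trees \<open>T\<^sub>p\<close> and the indices\<close>

definition lp_norm :: "ereal \<Rightarrow> real list \<Rightarrow> real" where
  "lp_norm p as =
     (if p = \<infinity> then Max (insert 0 (abs ` set as))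
      else (\<Sum>a\<leftarrow>as. \<bar>a\<bar> powr real_of_ereal p) powr (1 / real_of_ereal p))"

text \<open>Banach spaces are real, so the coefficients are real.\<close>

definition Tp :: "ereal \<Rightarrow> real \<Rightarrow> 'x::real_normed_vector list set" where
  "Tp p K =
     {xs. set xs \<subseteq> cball 0 1 \<and>
          (\<forall>as. length as = length xs \<and> lp_norm p as = 1 \<longrightarrow>
             inverse K \<le> norm (\<Sum>i<length xs. as ! i *\<^sub>R xs ! i) \<and>
             norm (\<Sum>i<length xs. as ! i *\<^sub>R xs ! i) \<le> 1)}"

definition Tp_block :: "ereal \<Rightarrow> (nat \<Rightarrow> 'x::banach set) \<Rightarrow> real \<Rightarrow> 'x list set" where
  "Tp_block p E K = Tp p K \<inter> block_sequences E"

definition index_p :: "ereal \<Rightarrow> 'x::banach itself \<Rightarrow> real \<Rightarrow> 'u ordinal extended" where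
  "index_p p X K = deriv_order tree_deriv (Tp p K :: 'x list set)"

definition block_index_p :: "ereal \<Rightarrow> (nat \<Rightarrow> 'x::banach set) \<Rightarrow> real \<Rightarrow> 'u ordinal extended" where
  "block_index_p p E K = deriv_order tree_deriv (Tp_block p E K)"

definition asymp_index_p :: "ereal \<Rightarrow> (nat \<Rightarrow> 'x::banach set) \<Rightarrow> real \<Rightarrow> 'u ordinal extended" where
  "asymp_index_p p E K = deriv_order (FDD_deriv E) (Tp_block p E K)"

section \<open>Schreier families and spreading models\<close>

definition fin_sets :: "nat set set" where
  "fin_sets = {E. finite E \<and> 0 \<notin> E}"

definition family_comp :: "nat set set \<Rightarrow> nat set set \<Rightarrow> nat set set" where
  "family_comp F G =
     insert {} {\<Union>(set Es) | Es. (\<forall>A\<in>set Es. A \<noteq> {} \<and> A \<in> G) \<and>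
        (\<forall>i. Suc i < length Es \<longrightarrow> Max (Es ! i) < Min (Es ! Suc i)) \<and> Min ` set Es \<in> F}"

definition schreier_1 :: "nat set set" where
  "schreier_1 = {E\<in>fin_sets. E = {} \<or> card E \<le> Min E}"

text \<open>
  \<open>\<phi> \<xi> n\<close>, \<open>n \<ge> 1\<close>, is the sequence fixed for the limit ordinal \<open>\<xi>\<close>; the families are those of the
  literature only if \<open>\<phi>\<close> satisfies \<open>fundamental_system\<close>. The condition \<open>n \<le> min E\<close> holds for
  \<open>E = {}\<close>. For \<open>\<xi> = 0\<close> the successor step gives \<open>schreier_1\<close>, see \<open>family_comp_singletons\<close>. The
  value above \<open>\<omega>\<^sub>1\<close> is never used.
\<close>

definition schreier :: "('u ordinal \<Rightarrow> nat \<Rightarrow> 'u ordinal) \<Rightarrow> 'u ordinal \<Rightarrow> nat set set" where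
  "schreier \<phi> \<xi> =
     (if \<xi> < omega1 then
        orec {E\<in>fin_sets. card E \<le> 1} (family_comp schreier_1)
          (\<lambda>\<xi> f. {E. \<exists>n\<ge>1. (\<forall>m\<in>E. n \<le> m) \<and> E \<in> f (osucc (\<phi> \<xi> n))}) \<xi>
      else fin_sets)"

definition fundamental_system :: "('u ordinal \<Rightarrow> nat \<Rightarrow> 'u ordinal) \<Rightarrow> bool" where
  "fundamental_system \<phi> \<longleftrightarrow>
     (\<forall>\<xi>. limit_ordinal \<xi> \<and> \<xi> < omega1 \<longrightarrow>
        (\<forall>n\<ge>1. \<phi> \<xi> n < \<phi> \<xi> (Suc n) \<and>
               schreier \<phi> (osucc (\<phi> \<xi> n)) \<subseteq> schreier \<phi> (\<phi> \<xi> (Suc n))) \<and>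
        osup (\<phi> \<xi> ` {1..}) = \<xi>)"

definition spreading_model ::
  "('u ordinal \<Rightarrow> nat \<Rightarrow> 'u ordinal) \<Rightarrow> ereal \<Rightarrow> real \<Rightarrow> 'u ordinal \<Rightarrow>
     (nat \<Rightarrow> 'x::real_normed_vector) \<Rightarrow> bool" where
  "spreading_model \<phi> p K \<xi> x \<longleftrightarrow>
     (\<forall>E\<in>schreier \<phi> \<xi>. map x (sorted_list_of_set E) \<in> Tp p K)"

definition SM ::
  "('u ordinal \<Rightarrow> nat \<Rightarrow> 'u ordinal) \<Rightarrow> ereal \<Rightarrow> 'x::banach itself \<Rightarrow> real \<Rightarrow> 'u ordinal extended" where
  "SM \<phi> p X K =
     (let N = {\<xi>. \<xi> \<le> omega1 \<and> \<not> (\<exists>x :: nat \<Rightarrow> 'x. spreading_model \<phi> p K \<xi> x)}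
      in if N \<noteq> {} then Fin (LEAST \<xi>. \<xi> \<in> N) else Pinf)"

lemma family_comp_singletons: "family_comp schreier_1 {E\<in>fin_sets. card E \<le> 1} = schreier_1"
    (is "?L = _")
proof (intro equalityI subsetI)
  fix E assume "E \<in> ?L"
  then consider "E = {}" | Es where "E = \<Union>(set Es)" "Min ` set Es \<in> schreier_1"
    "\<forall>A\<in>set Es. A \<noteq> {} \<and> finite A \<and> card A \<le> 1"
    unfolding family_comp_def fin_sets_def by blast
  then show "E \<in> schreier_1"
  proof cases
    case 2
    have "Min A \<in> A \<and> (\<forall>x\<in>A. x = Min A)" if A: "A \<in> set Es" for A
    proof -
      have "card A = 1" using 2(3) A by (simp add: le_antisym Suc_leI card_gt_0_iff)
      then obtain n where "A = {n}" by (rule card_1_singletonE)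
      then show ?thesis by simp
    qed
    then have "E = Min ` set Es" unfolding 2(1) image_def by blast
    then show ?thesis using 2(2) by simp
  qed (simp add: schreier_1_def fin_sets_def)
next
  fix E assume E: "E \<in> schreier_1"
  then have fin: "finite E" and "0 \<notin> E" by (auto simp: schreier_1_def fin_sets_def)
  define Es where "Es = map (\<lambda>n. {n}) (sorted_list_of_set E)"
  have 1: "E = \<Union>(set Es)" and 2: "Min ` set Es = E"
    using fin by (auto simp: Es_def image_image)
  have 3: "\<forall>A\<in>set Es. A \<noteq> {} \<and> A \<in> {E\<in>fin_sets. card E \<le> 1}"
    using fin \<open>0 \<notin> E\<close> by (auto simp: Es_def fin_sets_def intro: gr0I)
  have 4: "\<forall>i. Suc i < length Es \<longrightarrow> Max (Es ! i) < Min (Es ! Suc i)"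
    using sorted_wrt_nth_less[OF strict_sorted_list_of_set[of E]] by (auto simp: Es_def)
  show "E \<in> ?L"
    unfolding family_comp_def using 1 3 4 E[folded 2]
    by (intro insertI2 CollectI exI[of _ Es] conjI)
qed

section \<open>The classes\<close>

text \<open>
  A class of Banach spaces is a predicate on the types of sort \<open>banach\<close>; a class of pairs
  \<open>(E, X)\<close> is, for each such type \<open>X\<close>, a set of FDDs for it.
\<close>

definition P1_some :: "'u ordinal \<Rightarrow> ereal \<Rightarrow> 'x::banach itself \<Rightarrow> bool" where
  "P1_some \<xi> p X \<longleftrightarrow> (\<exists>K>1. index_p p X K > Fin (omega_pow \<xi>))"

definition P1_all :: "'u ordinal \<Rightarrow> ereal \<Rightarrow> 'x::banach itself \<Rightarrow> bool" where
  "P1_all \<xi> p X \<longleftrightarrow> (\<forall>K>1. index_p p X K > Fin (omega_pow \<xi>))"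

definition P2_some :: "'u ordinal \<Rightarrow> ereal \<Rightarrow> (nat \<Rightarrow> 'x::banach set) set" where
  "P2_some \<xi> p = {E. FDD E \<and> (\<exists>K>1. block_index_p p E K > Fin (omega_pow \<xi>))}"

definition P2_all :: "'u ordinal \<Rightarrow> ereal \<Rightarrow> (nat \<Rightarrow> 'x::banach set) set" where
  "P2_all \<xi> p = {E. FDD E \<and> (\<forall>K>1. block_index_p p E K > Fin (omega_pow \<xi>))}"

definition P3_some :: "'u ordinal \<Rightarrow> ereal \<Rightarrow> (nat \<Rightarrow> 'x::banach set) set" where
  "P3_some \<xi> p = {E. FDD E \<and> (\<exists>K>1. asymp_index_p p E K > Fin (omega_pow \<xi>))}"

definition P3_all :: "'u ordinal \<Rightarrow> ereal \<Rightarrow> (nat \<Rightarrow> 'x::banach set) set" where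
  "P3_all \<xi> p = {E. FDD E \<and> (\<forall>K>1. asymp_index_p p E K > Fin (omega_pow \<xi>))}"

definition P4_some ::
  "('u ordinal \<Rightarrow> nat \<Rightarrow> 'u ordinal) \<Rightarrow> 'u ordinal \<Rightarrow> ereal \<Rightarrow> 'x::banach itself \<Rightarrow> bool" where
  "P4_some \<phi> \<xi> p X \<longleftrightarrow> (\<exists>K>1. SM \<phi> p X K > Fin \<xi>)"

definition P4_all ::
  "('u ordinal \<Rightarrow> nat \<Rightarrow> 'u ordinal) \<Rightarrow> 'u ordinal \<Rightarrow> ereal \<Rightarrow> 'x::banach itself \<Rightarrow> bool" where
  "P4_all \<phi> \<xi> p X \<longleftrightarrow> (\<forall>K>1. SM \<phi> p X K > Fin \<xi>)"

end

theory Submission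
  imports Defs
begin

text \<open>
  The theorem is a transfinite form of James' distortion theorem for \<open>\<ell>\<^sub>1\<close> and \<open>c\<^sub>0\<close>. Each of the
  four classes says that a certain set of finite sequences, \<open>T\<^sub>p(X,K)\<close> or its part consisting of
  block sequences, is large: large derivation index for the first three classes, or containing
  \<open>(x\<^sub>n)\<close>, \<open>n \<in> E\<close>, for all \<open>E\<close> in a Schreier family for the fourth. What has to be shown is that
  largeness for one constant \<open>K\<close> passes to every constant \<open>K' > 1\<close>.

  James' argument takes one step from a constant \<open>D\<^sup>2\<close> to its square root. Suppose that a
  concatenation \<open>s\<^sub>1 \<dots> s\<^sub>m\<close> is good for the constant \<open>D\<^sup>2\<close>, but no single \<open>s\<^sub>j\<close> is good for \<open>D\<close>.
  Each \<open>s\<^sub>j\<close> then has a normalized linear combination that violates the estimate with constant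
  \<open>D\<close>. After rescaling by \<open>D\<close> these combinations \<open>y\<^sub>1, \<dots>, y\<^sub>m\<close> are good for \<open>D\<close>, since one factor
  \<open>D\<close> of \<open>D\<^sup>2\<close> was used up. Moreover \<open>y\<^sub>j\<close> depends on \<open>s\<^sub>j\<close> only. This is \<open>blocks_into\<close>, proved in
  \<open>lower_l1_blocking\<close> and \<open>upper_c0_blocking\<close>. For \<open>c\<^sub>0\<close> only upper estimates are improved:
  an upper constant near \<open>1\<close> gives a lower constant near \<open>1\<close> (\<open>upper_c0_lower_bound\<close>). Taking
  square roots repeatedly brings the constant down to any number above \<open>1\<close>.

  It remains to see that the notions of largeness survive blocking, which is \<open>stable_largeness\<close>;
  \<open>Tp_distortion\<close> then gives the conclusion for all of them at once. In each case there is a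
  dichotomy: either the good sequences for \<open>D\<close> are large already, or sequences that are bad for
  \<open>D\<close> can be found everywhere, and then the blocks \<open>y\<^sub>j\<close> are as rich as the sequences they come from.

  \<^item> For a derivation index (\<open>stable_largeness_der\<close>): if the tree \<open>B\<close> for \<open>D\<close> has empty derivative of
  order \<open>\<beta> < \<omega>^\<omega>^\<xi>\<close>, then between the derivatives of order \<open>\<beta> (\<gamma> + 1)\<close> and \<open>\<beta> \<gamma>\<close> of the tree
  \<open>A\<close> for \<open>D\<^sup>2\<close> there is room for a segment outside \<open>B\<close>. Replacing such segments by blocks turns
  a branch of \<open>A\<close> of order \<open>\<beta> \<beta>\<close> into one of \<open>B\<close> of order \<open>\<beta>\<close>. Since \<open>\<omega>^\<omega>^\<xi>\<close> is closed
  under \<open>\<beta> \<mapsto> \<beta> \<beta>\<close>, this is a contradiction. The same proof covers the ordinary and the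
  asymptotic derivative.

  \<^item> For spreading models (\<open>stable_largeness_spread_in\<close>): a union, over a set of the family of
  order \<open>\<delta>\<close>, of sufficiently sparse successive sets of the family of order \<open>\<zeta>\<close> belongs to the
  family of order \<open>\<zeta> + \<delta>\<close> (\<open>schreier_absorbs\<close>), and \<open>\<zeta> + \<alpha> = \<alpha>\<close> for \<open>\<zeta> < \<alpha>\<close> if \<open>\<alpha>\<close> is a power of \<open>\<omega>\<close>. So
  bad sets of order \<open>\<zeta> < \<alpha>\<close> that occur arbitrarily far out can be blocked without leaving the
  family of order \<open>\<alpha>\<close>; if they do not, a diagonal subsequence is good for \<open>D\<close>.
\<close>

section \<open>Ordinal arithmetic\<close>

lemma osup_image_le_iff:
  fixes f :: "'u ordinal \<Rightarrow> 'u ordinal"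
  shows "osup (f ` {..<\<gamma>}) \<le> \<alpha> \<longleftrightarrow> (\<forall>\<beta><\<gamma>. f \<beta> \<le> \<alpha>)"
  using osup_least_upper_bound[OF ordLeq_transitive[OF card_of_image card_of_initial_segment], of f \<gamma> \<alpha>]
  by auto

lemma less_osup_image_iff:
  fixes f :: "'u ordinal \<Rightarrow> 'u ordinal"
  shows "\<alpha> < osup (f ` {..<\<gamma>}) \<longleftrightarrow> (\<exists>\<beta><\<gamma>. \<alpha> < f \<beta>)"
  using osup_image_le_iff[of f \<gamma> \<alpha>] by (auto simp: not_le[symmetric])

lemma le_osup_image:
  fixes f :: "'u ordinal \<Rightarrow> 'u ordinal"
  shows "\<beta> < \<gamma> \<Longrightarrow> f \<beta> \<le> osup (f ` {..<\<gamma>})"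
  using osup_image_le_iff[of f \<gamma> "osup (f ` {..<\<gamma>})"] by simp

lemma countable_le_osup:
  fixes A :: "'u ordinal set"
  assumes "countable A"
  shows "osup A \<le> \<alpha> \<longleftrightarrow> (\<forall>\<beta>\<in>A. \<beta> \<le> \<alpha>)"
proof (rule osup_least_upper_bound)
  obtain f :: "'u ordinal \<Rightarrow> nat" where "inj_on f A" using assms by (auto simp: countable_def)
  then have "inj_on (\<lambda>a. Inr (real (f a)) :: 'u + real) A" by (auto simp: inj_on_def)
  then have "\<exists>f. inj_on f A \<and> f ` A \<subseteq> (UNIV :: ('u + real) set)" by blast
  then show "(card_of A, card_of (UNIV :: ('u + real) set)) \<in> ordLeq"
    by (simp only: card_of_ordLeq)
qed

lemma less_countable_osup:
  fixes A :: "'u ordinal set"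
  assumes "countable A"
  shows "\<alpha> < osup A \<longleftrightarrow> (\<exists>\<beta>\<in>A. \<alpha> < \<beta>)"
  using countable_le_osup[OF assms, of \<alpha>] by (auto simp: not_le[symmetric])

lemma osucc_le_iff: "osucc \<alpha> \<le> \<beta> \<longleftrightarrow> \<alpha> < \<beta>"
  by (metis leD leI less_osucc_iff)

lemma osucc_le_osucc_iff: "osucc \<alpha> \<le> osucc \<beta> \<longleftrightarrow> \<alpha> \<le> \<beta>"
  by (simp add: osucc_le_iff less_osucc_iff)

lemma ordinal_le_0_iff [simp]: "(\<alpha> :: 'u ordinal) \<le> 0 \<longleftrightarrow> \<alpha> = 0"
  by (metis ordinal_zero_le order_antisym order_refl)

lemma ordinal_not_less_0 [simp]: "\<not> (\<alpha> :: 'u ordinal) < 0"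
  by (simp add: not_less)

lemma ordinal_cases [case_names zero succ limit]:
  obtains "\<alpha> = 0" | \<beta> where "\<alpha> = osucc \<beta>" | "limit_ordinal \<alpha>"
  by (auto simp: limit_ordinal_def)

lemma limit_ordinal_osucc_less: "limit_ordinal \<gamma> \<Longrightarrow> \<beta> < \<gamma> \<Longrightarrow> osucc \<beta> < \<gamma>"
  by (metis limit_ordinal_def osucc_le_iff order_le_less)

lemma limit_ordinalI:
  assumes "\<gamma> \<noteq> 0" "\<And>\<beta>. \<beta> < \<gamma> \<Longrightarrow> osucc \<beta> < \<gamma>"
  shows "limit_ordinal \<gamma>"
  using assms osucc_greater by (fastforce simp: limit_ordinal_def)

lemma limit_ordinal_0_less: "limit_ordinal \<gamma> \<Longrightarrow> 0 < \<gamma>"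
  by (metis limit_ordinal_def ordinal_zero_le order_le_less)

lemma ordinal_induct [case_names zero succ limit]:
  assumes "P 0" "\<And>\<beta>. P \<beta> \<Longrightarrow> P (osucc \<beta>)"
    "\<And>\<gamma>. limit_ordinal \<gamma> \<Longrightarrow> (\<And>\<beta>. \<beta> < \<gamma> \<Longrightarrow> P \<beta>) \<Longrightarrow> P \<gamma>"
  shows "P (\<alpha> :: 'u ordinal)"
proof (induction \<alpha> rule: less_induct)
  case (less \<alpha>)
  show ?case by (cases \<alpha> rule: ordinal_cases) (use assms less osucc_greater in auto)
qed

lemma orec_osup_limit:
  "limit_ordinal \<gamma> \<Longrightarrow>
    orec z s (\<lambda>\<gamma> f. osup (f ` {..<\<gamma>})) \<gamma> = osup (orec z s (\<lambda>\<gamma> f. osup (f ` {..<\<gamma>})) ` {..<\<gamma>})"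
  by (rule orec_limit) (auto intro!: arg_cong[of _ _ osup] image_cong)

lemma ordinal_add_0 [simp]: "\<alpha> + 0 = (\<alpha> :: 'u ordinal)"
  by (simp add: plus_ordinal_def orec_0)

lemma ordinal_add_osucc: "\<alpha> + osucc \<beta> = osucc (\<alpha> + \<beta>)"
  by (simp add: plus_ordinal_def orec_osucc)

lemma ordinal_add_limit: "limit_ordinal \<gamma> \<Longrightarrow> \<alpha> + \<gamma> = osup ((+) \<alpha> ` {..<\<gamma>})"
  by (simp add: plus_ordinal_def orec_osup_limit)

lemma ordinal_mult_0 [simp]: "\<alpha> * 0 = (0 :: 'u ordinal)"
  by (simp add: times_ordinal_def orec_0)

lemma ordinal_mult_osucc: "\<alpha> * osucc \<beta> = \<alpha> * \<beta> + (\<alpha> :: 'u ordinal)"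
  by (simp add: times_ordinal_def orec_osucc)

lemma ordinal_mult_limit: "limit_ordinal \<gamma> \<Longrightarrow> \<alpha> * \<gamma> = osup ((*) \<alpha> ` {..<\<gamma>})"
  by (simp add: times_ordinal_def orec_osup_limit)

lemma omega_pow_0 [simp]: "omega_pow 0 = 1"
  by (simp add: omega_pow_def orec_0)

lemma omega_pow_osucc: "omega_pow (osucc \<xi>) = omega_pow \<xi> * omega"
  by (simp add: omega_pow_def orec_osucc)

lemma omega_pow_limit: "limit_ordinal \<gamma> \<Longrightarrow> omega_pow \<gamma> = osup (omega_pow ` {..<\<gamma>})"
  by (simp add: omega_pow_def orec_osup_limit)

lemma ordinal_add_le_mono_right: "\<beta> \<le> \<gamma> \<Longrightarrow> \<alpha> + \<beta> \<le> \<alpha> + (\<gamma> :: 'u ordinal)"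
proof (induction \<gamma> rule: ordinal_induct)
  case (succ \<gamma>)
  then show ?case
    by (metis less_osucc_iff ordinal_add_osucc order_le_less order_trans)
next
  case (limit \<gamma>)
  then show ?case using le_osup_image by (auto simp: ordinal_add_limit order_le_less)
qed simp

lemma ordinal_add_less_mono_right: "\<beta> < \<gamma> \<Longrightarrow> \<alpha> + \<beta> < \<alpha> + (\<gamma> :: 'u ordinal)"
  by (metis ordinal_add_le_mono_right ordinal_add_osucc osucc_le_iff)

lemma ordinal_le_add_left: "\<alpha> \<le> \<alpha> + (\<beta> :: 'u ordinal)"
  using ordinal_add_le_mono_right[of 0 \<beta> \<alpha>] by simp

lemma ordinal_add_mono_left: "\<alpha> \<le> \<beta> \<Longrightarrow> \<alpha> + \<gamma> \<le> \<beta> + (\<gamma> :: 'u ordinal)"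
proof (induction \<gamma> rule: ordinal_induct)
  case (succ \<gamma>)
  then show ?case by (simp add: ordinal_add_osucc osucc_le_osucc_iff)
next
  case (limit \<gamma>)
  then show ?case
    unfolding ordinal_add_limit[OF limit(1)] osup_image_le_iff by (meson le_osup_image order_trans)
qed simp

lemma ordinal_le_add_right: "\<beta> \<le> \<alpha> + (\<beta> :: 'u ordinal)"
proof (induction \<beta> rule: less_induct)
  case (less \<beta>)
  then show ?case by (metis leI order_le_less_trans ordinal_add_less_mono_right less_irrefl)
qed

lemma ordinal_0_add: "0 + \<beta> = (\<beta> :: 'u ordinal)"
proof (induction \<beta> rule: ordinal_induct)
  case (limit \<gamma>)
  then have "0 + \<gamma> \<le> \<gamma>"
    unfolding ordinal_add_limit[OF limit(1)] osup_image_le_iff by (simp add: less_imp_le)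
  then show ?case by (rule antisym[OF _ ordinal_le_add_right])
qed (simp_all add: ordinal_add_osucc)

lemma limit_ordinal_add:
  assumes "limit_ordinal \<gamma>"
  shows "limit_ordinal (\<alpha> + \<gamma>)"
proof (rule limit_ordinalI)
  show "\<alpha> + \<gamma> \<noteq> 0"
    by (metis assms limit_ordinal_0_less ordinal_add_less_mono_right ordinal_not_less_0)
next
  fix \<beta> assume "\<beta> < \<alpha> + \<gamma>"
  then obtain \<delta> where "\<delta> < \<gamma>" "\<beta> < \<alpha> + \<delta>"
    by (auto simp: ordinal_add_limit[OF assms] less_osup_image_iff)
  then show "osucc \<beta> < \<alpha> + \<gamma>"
    by (metis assms limit_ordinal_osucc_less ordinal_add_less_mono_right order_le_less_trans osucc_le_iff)
qed

lemma ordinal_add_assoc: "(\<alpha> + \<beta>) + \<gamma> = \<alpha> + (\<beta> + (\<gamma> :: 'u ordinal))"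
proof (induction \<gamma> rule: ordinal_induct)
  case (limit \<gamma>)
  show ?case
  proof (rule antisym)
    show "\<alpha> + \<beta> + \<gamma> \<le> \<alpha> + (\<beta> + \<gamma>)"
      unfolding ordinal_add_limit[OF limit(1), of "\<alpha> + \<beta>"] osup_image_le_iff
      by (simp add: limit.IH ordinal_add_le_mono_right)
    have "\<alpha> + \<delta> \<le> \<alpha> + \<beta> + \<gamma>" if "\<delta> < \<beta> + \<gamma>" for \<delta>
    proof -
      obtain \<epsilon> where "\<epsilon> < \<gamma>" "\<delta> < \<beta> + \<epsilon>"
        using \<open>\<delta> < \<beta> + \<gamma>\<close> by (auto simp: ordinal_add_limit[OF limit(1)] less_osup_image_iff)
      then have "\<alpha> + \<delta> \<le> \<alpha> + \<beta> + \<epsilon>" by (simp add: limit.IH ordinal_add_le_mono_right)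
      also have "\<dots> \<le> \<alpha> + \<beta> + \<gamma>" using \<open>\<epsilon> < \<gamma>\<close> by (simp add: ordinal_add_le_mono_right)
      finally show ?thesis .
    qed
    then show "\<alpha> + (\<beta> + \<gamma>) \<le> \<alpha> + \<beta> + \<gamma>"
      by (simp add: ordinal_add_limit[OF limit_ordinal_add[OF limit(1)], of \<alpha>] osup_image_le_iff)
  qed
qed (simp_all add: ordinal_add_osucc)

lemma ordinal_mult_mono_right: "\<beta> \<le> \<gamma> \<Longrightarrow> \<alpha> * \<beta> \<le> \<alpha> * (\<gamma> :: 'u ordinal)"
proof (induction \<gamma> rule: ordinal_induct)
  case (succ \<gamma>)
  then show ?case
    by (metis less_osucc_iff ordinal_mult_osucc ordinal_le_add_left order_le_less order_trans)
next
  case (limit \<gamma>)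
  then show ?case using le_osup_image by (auto simp: ordinal_mult_limit order_le_less)
qed simp

lemma ordinal_mult_mono_left: "\<alpha> \<le> \<beta> \<Longrightarrow> \<alpha> * \<gamma> \<le> \<beta> * (\<gamma> :: 'u ordinal)"
proof (induction \<gamma> rule: ordinal_induct)
  case (succ \<gamma>)
  then show ?case
    unfolding ordinal_mult_osucc by (meson ordinal_add_le_mono_right ordinal_add_mono_left order_trans)
next
  case (limit \<gamma>)
  then show ?case
    unfolding ordinal_mult_limit[OF limit(1)] osup_image_le_iff by (meson le_osup_image order_trans)
qed simp

text \<open>
  The half of left distributivity that bounds products of powers of \<open>\<omega>\<close> from above.
\<close>

lemma ordinal_mult_add_le: "\<alpha> * (\<beta> + \<gamma>) \<le> \<alpha> * \<beta> + \<alpha> * (\<gamma> :: 'u ordinal)"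
proof (induction \<gamma> rule: ordinal_induct)
  case (succ \<gamma>)
  then show ?case
    by (simp add: ordinal_add_osucc ordinal_mult_osucc ordinal_add_mono_left flip: ordinal_add_assoc)
next
  case (limit \<gamma>)
  have "\<alpha> * \<delta> \<le> \<alpha> * \<beta> + \<alpha> * \<gamma>" if "\<delta> < \<beta> + \<gamma>" for \<delta>
  proof -
    obtain \<epsilon> where \<epsilon>: "\<epsilon> < \<gamma>" "\<delta> < \<beta> + \<epsilon>"
      using \<open>\<delta> < \<beta> + \<gamma>\<close> by (auto simp: ordinal_add_limit[OF limit(1)] less_osup_image_iff)
    then have "\<alpha> * \<delta> \<le> \<alpha> * (\<beta> + \<epsilon>)" by (simp add: ordinal_mult_mono_right)
    also have "\<dots> \<le> \<alpha> * \<beta> + \<alpha> * \<epsilon>" using \<epsilon> by (simp add: limit.IH)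
    also have "\<dots> \<le> \<alpha> * \<beta> + \<alpha> * \<gamma>"
      using \<epsilon> by (simp add: ordinal_add_le_mono_right ordinal_mult_mono_right)
    finally show ?thesis .
  qed
  then show ?case
    by (simp add: ordinal_mult_limit[OF limit_ordinal_add[OF limit(1)], of \<alpha>] osup_image_le_iff)
qed simp

subsection \<open>Finite ordinals and \<open>\<omega>\<close>\<close>

abbreviation ofin :: "nat \<Rightarrow> 'u ordinal" where "ofin n \<equiv> (osucc ^^ n) 0"

lemma less_omega_iff: "\<alpha> < omega \<longleftrightarrow> (\<exists>n. \<alpha> < ofin n)"
  unfolding omega_def by (subst less_countable_osup) auto

lemma ofin_less_omega: "ofin n < omega"
  unfolding less_omega_iff by (rule exI[of _ "Suc n"]) (simp add: osucc_greater)

lemma less_ofin_imp: "\<alpha> < ofin n \<Longrightarrow> \<exists>m<n. \<alpha> = ofin m"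
  by (induction n) (auto simp: less_osucc_iff order_le_less less_Suc_eq)

lemma less_omegaE:
  assumes "\<alpha> < omega" obtains n where "\<alpha> = ofin n"
  using assms less_ofin_imp unfolding less_omega_iff by blast

lemma limit_ordinal_omega: "limit_ordinal omega"
proof (rule limit_ordinalI)
  show "omega \<noteq> (0 :: 'u ordinal)" using ofin_less_omega[of 0] by (metis ordinal_not_less_0)
  show "osucc \<beta> < omega" if "\<beta> < omega" for \<beta> :: "'u ordinal"
    using that ofin_less_omega[of "Suc _"] by (auto elim!: less_omegaE)
qed

lemma less_mult_omega_iff: "\<beta> < \<alpha> * omega \<longleftrightarrow> (\<exists>n. \<beta> < \<alpha> * ofin n)"
  unfolding ordinal_mult_limit[OF limit_ordinal_omega] less_osup_image_iff
  by (metis less_omegaE ofin_less_omega)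

lemma one_mult_ofin: "1 * ofin n = (ofin n :: 'u ordinal)"
  by (induction n) (simp_all add: ordinal_mult_osucc one_ordinal_def ordinal_add_osucc)

lemma one_mult_omega: "1 * omega = (omega :: 'u ordinal)"
  by (rule order.eq_iff[THEN iffD2])
    (metis less_mult_omega_iff less_omega_iff one_mult_ofin linorder_neq_iff order_le_less)

lemma ofin_mult: "ofin m * ofin n = (ofin (m * n) :: 'u ordinal)"
proof -
  have add: "ofin m + ofin n = (ofin (n + m) :: 'u ordinal)" for m n
    by (induction n) (simp_all add: ordinal_add_osucc)
  show ?thesis by (induction n) (simp_all add: ordinal_mult_osucc add)
qed

lemma less_one_ordinal_iff: "\<alpha> < 1 \<longleftrightarrow> \<alpha> = (0 :: 'u ordinal)"
  by (simp add: one_ordinal_def less_osucc_iff)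

subsection \<open>Powers of \<open>\<omega>\<close>\<close>

lemma omega_pow_pos: "0 < (omega_pow \<xi> :: 'u ordinal)"
proof (induction \<xi> rule: ordinal_induct)
  case zero
  then show ?case by (simp add: less_one_ordinal_iff)
next
  case (succ \<xi>)
  have "0 < omega_pow \<xi> * ofin 1" using succ
    by (simp add: ordinal_mult_osucc ordinal_0_add)
  then show ?case unfolding omega_pow_osucc less_mult_omega_iff by blast
next
  case (limit \<gamma>)
  then show ?case
    using limit_ordinal_0_less by (auto simp: omega_pow_limit less_osup_image_iff)
qed

lemma omega_pow_less_osucc: "omega_pow \<xi> < (omega_pow (osucc \<xi>) :: 'u ordinal)"
  unfolding omega_pow_osucc less_mult_omega_iff
  by (rule exI[of _ 2]) (use ordinal_add_less_mono_right[OF omega_pow_pos, of "omega_pow \<xi>" \<xi>] in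
      \<open>simp add: numeral_2_eq_2 ordinal_mult_osucc ordinal_0_add\<close>)

lemma omega_pow_mono: "\<xi> \<le> \<zeta> \<Longrightarrow> omega_pow \<xi> \<le> (omega_pow \<zeta> :: 'u ordinal)"
proof (induction \<zeta> rule: ordinal_induct)
  case (succ \<zeta>)
  then show ?case
    by (metis less_osucc_iff omega_pow_less_osucc order_le_less order_trans)
next
  case (limit \<gamma>)
  then show ?case using le_osup_image[of _ \<gamma> omega_pow] by (auto simp: omega_pow_limit order_le_less)
qed simp

lemma omega_pow_strict_mono: "\<xi> < \<zeta> \<Longrightarrow> omega_pow \<xi> < (omega_pow \<zeta> :: 'u ordinal)"
  by (meson omega_pow_less_osucc omega_pow_mono order_less_le_trans osucc_le_iff)

text \<open>
  At a successor, \<open>\<zeta>\<close> and \<open>\<eta>\<close> lie below finite multiples of the previous power of \<open>\<omega>\<close>, and adding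
  one more copy of this power to a number below a finite multiple leads to a number below the
  next one.
\<close>

lemma omega_pow_additively_closed:
  "\<zeta> < omega_pow \<xi> \<Longrightarrow> \<eta> < omega_pow \<xi> \<Longrightarrow> \<zeta> + \<eta> < (omega_pow \<xi> :: 'u ordinal)"
proof (induction \<xi> arbitrary: \<zeta> \<eta> rule: ordinal_induct)
  case zero
  then show ?case by (simp add: less_one_ordinal_iff)
next
  case (succ \<xi>)
  let ?\<alpha> = "omega_pow \<xi>"
  obtain n where n: "\<eta> < ?\<alpha> * ofin n"
    using succ.prems(2) unfolding omega_pow_osucc less_mult_omega_iff by blast
  have "\<zeta> + ?\<alpha> * ofin k < ?\<alpha> * omega" for k
  proof (induction k)
    case 0
    then show ?case using succ.prems(1) by (simp add: omega_pow_osucc)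
  next
    case (Suc k)
    then obtain m where "\<zeta> + ?\<alpha> * ofin k < ?\<alpha> * ofin m" unfolding less_mult_omega_iff by blast
    then have "\<zeta> + ?\<alpha> * ofin (Suc k) \<le> ?\<alpha> * ofin (Suc m)"
      by (simp add: ordinal_mult_osucc ordinal_add_mono_left flip: ordinal_add_assoc)
    also have "\<dots> < ?\<alpha> * ofin (Suc (Suc m))"
      using ordinal_add_less_mono_right[OF omega_pow_pos] by (simp add: ordinal_mult_osucc)
    finally show ?case unfolding less_mult_omega_iff by blast
  qed
  then show ?case
    using ordinal_add_less_mono_right[OF n, of \<zeta>] unfolding omega_pow_osucc by (meson order_less_trans)
next
  case (limit \<gamma>)
  then obtain \<xi> where "\<xi> < \<gamma>" "\<zeta> < omega_pow \<xi>" "\<eta> < omega_pow \<xi>"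
    unfolding omega_pow_limit[OF limit(1)] less_osup_image_iff
    by (metis linorder_le_cases omega_pow_mono order_less_le_trans)
  then show ?case using limit.IH omega_pow_strict_mono by (meson order_less_trans)
qed

lemma limit_ordinal_omega_pow:
  assumes "0 < (\<xi> :: 'u ordinal)" shows "limit_ordinal (omega_pow \<xi> :: 'u ordinal)"
proof (rule limit_ordinalI)
  show "omega_pow \<xi> \<noteq> 0" by (metis omega_pow_pos less_irrefl)
  have "1 < omega_pow \<xi>" using omega_pow_strict_mono[OF assms] by simp
  then show "osucc \<beta> < omega_pow \<xi>" if "\<beta> < omega_pow \<xi>" for \<beta>
    using omega_pow_additively_closed[OF that, of 1] by (simp add: one_ordinal_def ordinal_add_osucc)
qed

lemma add_omega_pow_absorb:
  assumes "\<zeta> < omega_pow \<xi>" "0 < \<xi>" shows "\<zeta> + omega_pow \<xi> = (omega_pow \<xi> :: 'u ordinal)"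
proof (rule antisym)
  show "\<zeta> + omega_pow \<xi> \<le> omega_pow \<xi>"
    unfolding ordinal_add_limit[OF limit_ordinal_omega_pow[OF assms(2)]] osup_image_le_iff
    using omega_pow_additively_closed[OF assms(1)] by (simp add: less_imp_le)
  show "omega_pow \<xi> \<le> \<zeta> + omega_pow \<xi>"
    by (rule ordinal_le_add_right)
qed

lemma mult_mult_omega_le:
  assumes "0 < \<beta>" shows "\<alpha> * (\<beta> * omega) \<le> (\<alpha> * \<beta>) * (omega :: 'u ordinal)"
proof -
  have lim: "limit_ordinal (\<beta> * omega)"
  proof (rule limit_ordinalI)
    have step: "\<exists>n. \<delta> < \<beta> * ofin n \<Longrightarrow> osucc \<delta> < \<beta> * omega" for \<delta>
    proof -
      assume "\<exists>n. \<delta> < \<beta> * ofin n"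
      then obtain n where "osucc \<delta> \<le> \<beta> * ofin n" by (auto simp: osucc_le_iff)
      also have "\<dots> < \<beta> * ofin (Suc n)"
        using ordinal_add_less_mono_right[OF assms] by (simp add: ordinal_mult_osucc)
      finally show ?thesis unfolding less_mult_omega_iff by blast
    qed
    then show "osucc \<delta> < \<beta> * omega" if "\<delta> < \<beta> * omega" for \<delta>
      using that by (simp add: less_mult_omega_iff)
    have "0 < \<beta> * ofin 1" using assms by (simp add: ordinal_mult_osucc ordinal_0_add)
    then have "0 < \<beta> * omega" unfolding less_mult_omega_iff by blast
    then show "\<beta> * omega \<noteq> 0" by auto
  qed
  have fin: "\<alpha> * (\<beta> * ofin n) \<le> (\<alpha> * \<beta>) * ofin n" for n
  proof (induction n)
    case (Suc n)
    have "\<alpha> * (\<beta> * ofin n + \<beta>) \<le> \<alpha> * (\<beta> * ofin n) + \<alpha> * \<beta>" by (rule ordinal_mult_add_le)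
    also have "\<dots> \<le> \<alpha> * \<beta> * ofin n + \<alpha> * \<beta>" by (rule ordinal_add_mono_left[OF Suc])
    finally show ?case by (simp add: ordinal_mult_osucc)
  qed simp
  show ?thesis
    unfolding ordinal_mult_limit[OF lim] osup_image_le_iff
  proof (intro allI impI)
    fix \<delta> assume "\<delta> < \<beta> * omega"
    then obtain n where "\<delta> < \<beta> * ofin n" unfolding less_mult_omega_iff by blast
    then have "\<alpha> * \<delta> \<le> \<alpha> * \<beta> * ofin n"
      using fin[of n] ordinal_mult_mono_right less_imp_le order_trans by metis
    also have "\<dots> \<le> \<alpha> * \<beta> * omega"
      by (rule ordinal_mult_mono_right[OF less_imp_le[OF ofin_less_omega]])
    finally show "\<alpha> * \<delta> \<le> \<alpha> * \<beta> * omega" .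
  qed
qed

lemma omega_pow_mult_le: "omega_pow \<zeta> * omega_pow \<eta> \<le> (omega_pow (\<zeta> + \<eta>) :: 'u ordinal)"
proof (induction \<eta> rule: ordinal_induct)
  case zero
  then show ?case by (simp add: one_ordinal_def ordinal_mult_osucc ordinal_0_add)
next
  case (succ \<eta>)
  have "omega_pow \<zeta> * omega_pow (osucc \<eta>) \<le> omega_pow \<zeta> * omega_pow \<eta> * omega"
    unfolding omega_pow_osucc by (rule mult_mult_omega_le[OF omega_pow_pos])
  also have "\<dots> \<le> omega_pow (\<zeta> + \<eta>) * omega" by (rule ordinal_mult_mono_left[OF succ])
  finally show ?case by (simp add: ordinal_add_osucc omega_pow_osucc)
next
  case (limit \<gamma>)
  have lim: "limit_ordinal (omega_pow \<gamma>)"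
    by (rule limit_ordinal_omega_pow[OF limit_ordinal_0_less[OF limit(1)]])
  show ?case
    unfolding ordinal_mult_limit[OF lim] osup_image_le_iff
  proof (intro allI impI)
    fix \<delta> assume "\<delta> < omega_pow \<gamma>"
    then obtain \<eta> where \<eta>: "\<eta> < \<gamma>" "\<delta> < omega_pow \<eta>"
      unfolding omega_pow_limit[OF limit(1)] less_osup_image_iff by blast
    then have "omega_pow \<zeta> * \<delta> \<le> omega_pow \<zeta> * omega_pow \<eta>" by (simp add: ordinal_mult_mono_right)
    also have "\<dots> \<le> omega_pow (\<zeta> + \<eta>)" by (rule limit.IH[OF \<eta>(1)])
    also have "\<dots> \<le> omega_pow (\<zeta> + \<gamma>)"
      using \<eta> by (intro omega_pow_mono ordinal_add_le_mono_right) simp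
    finally show "omega_pow \<zeta> * \<delta> \<le> omega_pow (\<zeta> + \<gamma>)" .
  qed
qed

text \<open>
  A number below \<open>\<omega>^\<omega>^\<xi>\<close> is below some \<open>\<omega>^\<zeta>\<close> with \<open>\<zeta> < \<omega>^\<xi>\<close>, and \<open>\<zeta> + \<zeta>\<close> is still below
  \<open>\<omega>^\<xi>\<close>. The case \<open>\<xi> = 0\<close> is separate, because then the exponent \<open>\<omega>^\<xi> = 1\<close> is not a limit.
\<close>

lemma omega_pow_omega_pow_square_closed:
  assumes "\<beta> < omega_pow (omega_pow \<xi>)"
  shows "\<beta> * \<beta> < (omega_pow (omega_pow \<xi>) :: 'u ordinal)"
proof (cases "\<xi> = 0")
  case True
  have eq: "omega_pow (omega_pow \<xi>) = (omega :: 'u ordinal)"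
    by (simp add: True one_ordinal_def omega_pow_osucc) (simp add: one_mult_omega flip: one_ordinal_def)
  show ?thesis
    using assms unfolding eq by (auto elim!: less_omegaE simp: ofin_mult ofin_less_omega)
next
  case False
  then have "limit_ordinal (omega_pow \<xi>)"
    by (intro limit_ordinal_omega_pow) (metis ordinal_zero_le order_le_less)
  then obtain \<zeta> where \<zeta>: "\<zeta> < omega_pow \<xi>" "\<beta> < omega_pow \<zeta>"
    using assms by (auto simp: omega_pow_limit less_osup_image_iff)
  have "\<beta> * \<beta> \<le> omega_pow \<zeta> * omega_pow \<zeta>"
    using \<zeta>(2) by (meson less_imp_le order_trans ordinal_mult_mono_left ordinal_mult_mono_right)
  also have "\<dots> \<le> omega_pow (\<zeta> + \<zeta>)" by (rule omega_pow_mult_le)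
  also have "\<dots> < omega_pow (omega_pow \<xi>)"
    by (rule omega_pow_strict_mono[OF omega_pow_additively_closed[OF \<zeta>(1) \<zeta>(1)]])
  finally show ?thesis .
qed

section \<open>Blocking and notions of largeness\<close>

definition subseq_closed :: "'a list set \<Rightarrow> bool" where
  "subseq_closed A \<longleftrightarrow> (\<forall>xs\<in>A. \<forall>ys. subseq ys xs \<longrightarrow> ys \<in> A)"

text \<open>
  The outcome of one step of James' argument, with \<open>A\<close> the sequences that are good for the old
  constant and \<open>B\<close> those that are good for the new one. It matters that \<open>f\<close> sees one segment at a
  time: a block can then be chosen before the later segments are known.
\<close>

definition blocks_into ::
  "('x::real_vector list \<Rightarrow> 'x) \<Rightarrow> 'x list set \<Rightarrow> 'x list set \<Rightarrow> bool" where
  "blocks_into f A B \<longleftrightarrow>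
     (\<forall>ss. concat ss \<in> A \<longrightarrow> (\<forall>s\<in>set ss. s \<notin> B) \<longrightarrow>
        map f ss \<in> B \<and> (\<forall>s\<in>set ss. f s \<in> span (set s) \<and> f s \<noteq> 0))"

text \<open>
  The two properties of a notion of largeness that James' argument uses: it is preserved by
  rescaling (with \<open>c = 1\<close>, by passing to a larger set) and by blocking.
\<close>

definition stable_largeness :: "('x::real_vector list set \<Rightarrow> bool) \<Rightarrow> bool" where
  "stable_largeness L \<longleftrightarrow>
     (\<forall>A B c. c \<noteq> 0 \<longrightarrow> map (scaleR c) ` A \<subseteq> B \<longrightarrow> L A \<longrightarrow> L B) \<and>
     (\<forall>A B f. subseq_closed A \<longrightarrow> subseq_closed B \<longrightarrow> [] \<in> B \<longrightarrow>
        blocks_into f A B \<longrightarrow> L A \<longrightarrow> L B)"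

abbreviation lincomb :: "real list \<Rightarrow> 'x::real_vector list \<Rightarrow> 'x" where
  "lincomb as xs \<equiv> sum_list (map2 scaleR as xs)"

abbreviation sum_abs :: "real list \<Rightarrow> real" where
  "sum_abs as \<equiv> sum_list (map abs as)"

lemma lincomb_conv_sum:
  "length as = length xs \<Longrightarrow> lincomb as xs = (\<Sum>i<length xs. as ! i *\<^sub>R xs ! i)"
  by (simp add: sum_list_sum_nth atLeast0LessThan)

lemma lincomb_in_span: "lincomb as xs \<in> span (set xs)"
proof (induction as xs rule: list_induct2')
  case (4 a as x xs)
  have "span (set xs) \<subseteq> span (set (x # xs))" by (intro span_mono) auto
  with 4 show ?case by (auto intro!: span_add span_scale intro: span_base)
qed (simp_all add: span_zero)

lemma lincomb_scale_left: "lincomb (map ((*) b) as) xs = b *\<^sub>R lincomb as xs"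
  by (induction as xs rule: list_induct2') (simp_all add: scaleR_add_right)

lemma lincomb_scale_right: "lincomb as (map (scaleR b) xs) = b *\<^sub>R lincomb as xs"
  by (induction as xs rule: list_induct2') (simp_all add: scaleR_add_right)

lemma lincomb_append:
  "length as = length xs \<Longrightarrow> lincomb (as @ bs) (xs @ ys) = lincomb as xs + lincomb bs ys"
  by simp

lemma sum_abs_scale: "sum_abs (map ((*) b) as) = \<bar>b\<bar> * sum_abs as"
  by (induction as) (simp_all add: abs_mult distrib_left)

text \<open>
  This transfers estimates from the concatenation to the blocks: expanding a combination of blocks
  preserves the normalization of the coefficients, in \<open>\<ell>\<^sub>1\<close> as well as in the unit ball of \<open>\<ell>\<^sub>\<infinity>\<close>.
\<close>

lemma lincomb_blocks:
  fixes g :: "'x::real_vector list \<Rightarrow> real list"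
  assumes "length bs = length ss" "\<forall>s\<in>set ss. length (g s) = length s"
  defines "as \<equiv> concat (map2 (\<lambda>b s. map ((*) b) (g s)) bs ss)"
  shows "length as = length (concat ss)"
    and "lincomb as (concat ss) = lincomb bs (map (\<lambda>s. lincomb (g s) s) ss)"
    and "(\<forall>s\<in>set ss. sum_abs (g s) = 1) \<Longrightarrow> sum_abs as = sum_abs bs"
    and "(\<forall>b\<in>set bs. \<bar>b\<bar> \<le> 1) \<Longrightarrow> (\<forall>s\<in>set ss. \<forall>a\<in>set (g s). \<bar>a\<bar> \<le> 1) \<Longrightarrow> \<forall>a\<in>set as. \<bar>a\<bar> \<le> 1"
proof -
  have "length as = length (concat ss) \<and>
    lincomb as (concat ss) = lincomb bs (map (\<lambda>s. lincomb (g s) s) ss) \<and>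
    ((\<forall>s\<in>set ss. sum_abs (g s) = 1) \<longrightarrow> sum_abs as = sum_abs bs) \<and>
    ((\<forall>b\<in>set bs. \<bar>b\<bar> \<le> 1) \<longrightarrow> (\<forall>s\<in>set ss. \<forall>a\<in>set (g s). \<bar>a\<bar> \<le> 1) \<longrightarrow> (\<forall>a\<in>set as. \<bar>a\<bar> \<le> 1))"
    using assms(1,2) unfolding as_def
  proof (induction bs ss rule: list_induct2)
    case (Cons b bs s ss)
    let ?as = "concat (map2 (\<lambda>b s. map ((*) b) (g s)) bs ss)"
    have len: "length (map ((*) b) (g s)) = length s" using Cons.prems by simp
    have IH: "length ?as = length (concat ss)"
      "lincomb ?as (concat ss) = lincomb bs (map (\<lambda>s. lincomb (g s) s) ss)"
      "(\<forall>s\<in>set ss. sum_abs (g s) = 1) \<Longrightarrow> sum_abs ?as = sum_abs bs"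
      "(\<forall>b\<in>set bs. \<bar>b\<bar> \<le> 1) \<Longrightarrow> (\<forall>s\<in>set ss. \<forall>a\<in>set (g s). \<bar>a\<bar> \<le> 1) \<Longrightarrow> \<forall>a\<in>set ?as. \<bar>a\<bar> \<le> 1"
      using Cons.IH Cons.prems by simp_all
    have as: "concat (map2 (\<lambda>b s. map ((*) b) (g s)) (b # bs) (s # ss)) = map ((*) b) (g s) @ ?as"
      by simp
    show ?case
      unfolding as
    proof (intro conjI impI)
      show "length (map ((*) b) (g s) @ ?as) = length (concat (s # ss))"
        using len IH(1) by simp
      show "lincomb (map ((*) b) (g s) @ ?as) (concat (s # ss)) =
          lincomb (b # bs) (map (\<lambda>s. lincomb (g s) s) (s # ss))"
        unfolding concat.simps lincomb_append[OF len] lincomb_scale_left IH(2) by simp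
      show "sum_abs (map ((*) b) (g s) @ ?as) = sum_abs (b # bs)" if "\<forall>s\<in>set (s # ss). sum_abs (g s) = 1"
        using IH(3) that by (simp only: map_append sum_list_append sum_abs_scale) simp
      show "\<forall>a\<in>set (map ((*) b) (g s) @ ?as). \<bar>a\<bar> \<le> 1"
        if "\<forall>b\<in>set (b # bs). \<bar>b\<bar> \<le> 1" "\<forall>s\<in>set (s # ss). \<forall>a\<in>set (g s). \<bar>a\<bar> \<le> 1"
      proof
        fix a assume "a \<in> set (map ((*) b) (g s) @ ?as)"
        then consider c where "c \<in> set (g s)" "a = b * c" | "a \<in> set ?as" by auto
        then show "\<bar>a\<bar> \<le> 1"
        proof cases
          case 1
          then show ?thesis using that by (simp add: abs_mult mult_le_one)
        next
          case 2
          then show ?thesis using bspec[OF IH(4), of a] that unfolding list.set by blast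
        qed
      qed
    qed
  qed simp
  then show "length as = length (concat ss)"
    and "lincomb as (concat ss) = lincomb bs (map (\<lambda>s. lincomb (g s) s) ss)"
    and "(\<forall>s\<in>set ss. sum_abs (g s) = 1) \<Longrightarrow> sum_abs as = sum_abs bs"
    and "(\<forall>b\<in>set bs. \<bar>b\<bar> \<le> 1) \<Longrightarrow> (\<forall>s\<in>set ss. \<forall>a\<in>set (g s). \<bar>a\<bar> \<le> 1) \<Longrightarrow> \<forall>a\<in>set as. \<bar>a\<bar> \<le> 1"
    by blast+
qed

lemma set_subseq_mono: "subseq ys xs \<Longrightarrow> set ys \<subseteq> set xs"
  by (induction rule: list_emb.induct) auto

text \<open>Coefficients are extended from a subsequence by zeros.\<close>

lemma subseq_lincomb:
  assumes "subseq ys xs" "length as = length ys"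
  shows "\<exists>bs. length bs = length xs \<and> lincomb bs xs = lincomb as ys \<and>
    sum_abs bs = sum_abs as \<and> set as \<subseteq> set bs \<and> set bs \<subseteq> insert 0 (set as)"
  using assms
proof (induction arbitrary: as rule: list_emb.induct)
  case (list_emb_Nil xs)
  then show ?case
    by (intro exI[of _ "replicate (length xs) 0"])
       (auto simp: zip_replicate1 sum_list_replicate o_def)
next
  case (list_emb_Cons ys xs x)
  then obtain bs where "length bs = length xs \<and> lincomb bs xs = lincomb as ys \<and>
    sum_abs bs = sum_abs as \<and> set as \<subseteq> set bs \<and> set bs \<subseteq> insert 0 (set as)" by blast
  then show ?case by (intro exI[of _ "0 # bs"]) auto
next
  case (list_emb_Cons2 y x ys xs)
  then obtain a as' where as: "as = a # as'" "length as' = length ys" by (cases as) auto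
  with list_emb_Cons2 obtain bs where "length bs = length xs \<and> lincomb bs xs = lincomb as' ys \<and>
    sum_abs bs = sum_abs as' \<and> set as' \<subseteq> set bs \<and> set bs \<subseteq> insert 0 (set as')" by blast
  then show ?case using as list_emb_Cons2 by (intro exI[of _ "a # bs"]) auto
qed

section \<open>Improving the constant\<close>

text \<open>
  The two one-sided estimates to which the condition defining \<open>T\<^sub>p\<close> reduces for \<open>p = 1\<close> and, up to
  rescaling and a change of the constant, for \<open>p = \<infinity>\<close>.
  For \<open>\<ell>\<^sub>1\<close> the upper estimate is the triangle inequality. For \<open>c\<^sub>0\<close> vectors are normalized from
  below, so that the estimate to be improved is the upper one.
\<close>

definition lower_l1 :: "real \<Rightarrow> 'x::real_normed_vector list set" where
  "lower_l1 C = {xs. (\<forall>x\<in>set xs. norm x \<le> 1) \<and>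
     (\<forall>as. length as = length xs \<longrightarrow> sum_abs as = 1 \<longrightarrow> 1 / C \<le> norm (lincomb as xs))}"

definition upper_c0 :: "real \<Rightarrow> 'x::real_normed_vector list set" where
  "upper_c0 C = {xs. (\<forall>x\<in>set xs. 1 \<le> norm x) \<and>
     (\<forall>as. length as = length xs \<longrightarrow> (\<forall>a\<in>set as. \<bar>a\<bar> \<le> 1) \<longrightarrow> norm (lincomb as xs) \<le> C)}"

lemma subseq_closed_lower_l1: "subseq_closed (lower_l1 C)"
  unfolding subseq_closed_def
proof (intro ballI allI impI)
  fix xs ys :: "'a list" assume *: "xs \<in> lower_l1 C" "subseq ys xs"
  have "set ys \<subseteq> set xs" by (rule set_subseq_mono[OF *(2)])
  moreover have "1 / C \<le> norm (lincomb as ys)" if as: "length as = length ys" "sum_abs as = 1" for as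
  proof -
    obtain bs where bs: "length bs = length xs"
      "lincomb bs xs = lincomb as ys" "sum_abs bs = sum_abs as"
      using subseq_lincomb[OF *(2) as(1)] by (elim exE conjE) (rule that)
    have "1 / C \<le> norm (lincomb bs xs)"
      using *(1) as(2) bs(1,3) unfolding lower_l1_def by simp
    then show ?thesis by (simp only: bs(2))
  qed
  moreover have "\<forall>x\<in>set xs. norm x \<le> 1" by (rule conjunct1[OF *(1)[unfolded lower_l1_def mem_Collect_eq]])
  ultimately show "ys \<in> lower_l1 C" unfolding lower_l1_def by blast
qed

lemma subseq_closed_upper_c0: "subseq_closed (upper_c0 C)"
  unfolding subseq_closed_def
proof (intro ballI allI impI)
  fix xs ys :: "'a list" assume *: "xs \<in> upper_c0 C" "subseq ys xs"
  have "set ys \<subseteq> set xs" by (rule set_subseq_mono[OF *(2)])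
  moreover have "norm (lincomb as ys) \<le> C"
    if as: "length as = length ys" "\<forall>a\<in>set as. \<bar>a\<bar> \<le> 1" for as
  proof -
    obtain bs where bs: "length bs = length xs"
      "lincomb bs xs = lincomb as ys" "set bs \<subseteq> insert 0 (set as)"
      using subseq_lincomb[OF *(2) as(1)] by (elim exE conjE) (rule that)
    have "\<bar>b\<bar> \<le> 1" if "b \<in> set bs" for b
      using subsetD[OF bs(3) that] as(2) by auto
    then have "norm (lincomb bs xs) \<le> C" using *(1) bs(1) unfolding upper_c0_def by simp
    then show ?thesis by (simp only: bs(2))
  qed
  moreover have "\<forall>x\<in>set xs. 1 \<le> norm x"
    by (rule conjunct1[OF *(1)[unfolded upper_c0_def mem_Collect_eq]])
  ultimately show "ys \<in> upper_c0 C" unfolding upper_c0_def by blast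
qed

lemma subseq_concat: "s \<in> set ss \<Longrightarrow> subseq s (concat ss)"
  by (induction ss) (auto intro: list_emb_append2 subseq_rev_drop_many)

lemma norm_lincomb_le_sum_abs:
  "\<forall>x\<in>set xs. norm (x :: 'x::real_normed_vector) \<le> 1 \<Longrightarrow> length as = length xs \<Longrightarrow>
    norm (lincomb as xs) \<le> sum_abs as"
proof (induction xs arbitrary: as)
  case (Cons x xs)
  then obtain a bs where "as = a # bs" "length bs = length xs" by (cases as) auto
  moreover have "norm (a *\<^sub>R x + lincomb bs xs) \<le> \<bar>a\<bar> * 1 + sum_abs bs"
    using Cons calculation
    by (intro norm_triangle_mono) (auto simp: mult_left_le)
  ultimately show ?case by simp
qed simp

text \<open>
  James' blocking for \<open>\<ell>\<^sub>1\<close>: a segment that is bad for \<open>D\<close> has a combination of norm below \<open>1 / D\<close>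
  with coefficients of \<open>\<ell>\<^sub>1\<close>-norm \<open>1\<close>. Multiplied by \<open>D\<close>, it stays in the unit ball, while the lower
  bound \<open>1 / D\<^sup>2\<close> on combinations of the whole sequence becomes \<open>1 / D\<close>.
\<close>

lemma lower_l1_blocking:
  assumes "D > 0"
  shows "\<exists>f. blocks_into f (lower_l1 (D\<^sup>2)) (lower_l1 D :: 'x::real_normed_vector list set)"
proof -
  have "\<exists>as. (\<forall>x\<in>set s. norm x \<le> 1) \<longrightarrow> s \<notin> lower_l1 D \<longrightarrow>
      length as = length s \<and> sum_abs as = 1 \<and> norm (lincomb as s) < 1 / D" for s :: "'x list"
    unfolding lower_l1_def by (auto simp: not_le)
  then obtain g where g: "(\<forall>x\<in>set s. norm x \<le> 1) \<Longrightarrow> s \<notin> lower_l1 D \<Longrightarrow>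
      length (g s) = length s \<and> sum_abs (g s) = 1 \<and> norm (lincomb (g s) s) < 1 / D"
    for s :: "'x list" by metis
  define f where "f s = D *\<^sub>R lincomb (g s) s" for s
  have "map f ss \<in> lower_l1 D \<and> (\<forall>s\<in>set ss. f s \<in> span (set s) \<and> f s \<noteq> 0)"
    if ss: "concat ss \<in> lower_l1 (D\<^sup>2)" "\<forall>s\<in>set ss. s \<notin> lower_l1 D" for ss
  proof -
    have gs: "length (g s) = length s" "sum_abs (g s) = 1" "norm (lincomb (g s) s) < 1 / D"
      if "s \<in> set ss" for s
      using g[of s] ss that by (auto simp: lower_l1_def)
    have "norm (f s) \<le> 1" if "s \<in> set ss" for s
      using gs(3)[OF that] \<open>D > 0\<close> by (simp add: f_def field_simps)
    moreover have low: "1 / D \<le> norm (lincomb bs (map f ss))"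
      if bs: "length bs = length ss" "sum_abs bs = 1" for bs
    proof -
      note blocks = lincomb_blocks[OF bs(1), of g]
      have len: "\<forall>s\<in>set ss. length (g s) = length s" using gs(1) by blast
      have "lincomb bs (map f ss) = D *\<^sub>R lincomb bs (map (\<lambda>s. lincomb (g s) s) ss)"
        unfolding lincomb_scale_right[symmetric] map_map by (simp only: f_def[abs_def] o_def)
      moreover have "1 / D\<^sup>2 \<le> norm (lincomb bs (map (\<lambda>s. lincomb (g s) s) ss))"
        unfolding blocks(2)[OF len, symmetric] using ss(1) blocks(1)[OF len] blocks(3)[OF len] gs(2) bs(2)
        unfolding lower_l1_def by simp
      then have "D * (1 / D\<^sup>2) \<le> D * norm (lincomb bs (map (\<lambda>s. lincomb (g s) s) ss))"
        using \<open>D > 0\<close> by (intro mult_left_mono) auto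
      ultimately show ?thesis using \<open>D > 0\<close> by (simp add: power2_eq_square)
    qed
    moreover have "f s \<noteq> 0" if "s \<in> set ss" for s
    proof
      have "s \<in> lower_l1 (D\<^sup>2)"
        using subseq_closed_lower_l1 subseq_concat[OF that] ss(1) by (auto simp: subseq_closed_def)
      then have "1 / D\<^sup>2 \<le> norm (lincomb (g s) s)" using gs(1,2)[OF that] unfolding lower_l1_def by blast
      moreover assume "f s = 0"
      moreover have "0 < 1 / D\<^sup>2" using \<open>D > 0\<close> by simp
      ultimately show False using \<open>D > 0\<close> by (simp add: f_def)
    qed
    ultimately show ?thesis
      unfolding lower_l1_def by (auto simp: f_def intro!: span_scale lincomb_in_span)
  qed
  then show ?thesis unfolding blocks_into_def by blast
qed

text \<open>
  The dual argument for \<open>c\<^sub>0\<close>: a segment that is bad for \<open>D\<close> has a combination of norm above \<open>D\<close> with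
  coefficients of modulus at most \<open>1\<close>. Divided by \<open>D\<close>, it still has norm at least \<open>1\<close>, while the
  upper bound \<open>D\<^sup>2\<close> becomes \<open>D\<close>.
\<close>

lemma upper_c0_blocking:
  assumes "D > 0"
  shows "\<exists>f. blocks_into f (upper_c0 (D\<^sup>2)) (upper_c0 D :: 'x::real_normed_vector list set)"
proof -
  have "\<exists>as. (\<forall>x\<in>set s. 1 \<le> norm x) \<longrightarrow> s \<notin> upper_c0 D \<longrightarrow>
      length as = length s \<and> (\<forall>a\<in>set as. \<bar>a\<bar> \<le> 1) \<and> D < norm (lincomb as s)" for s :: "'x list"
    unfolding upper_c0_def by (auto simp: not_le)
  then obtain g where g: "(\<forall>x\<in>set s. 1 \<le> norm x) \<Longrightarrow> s \<notin> upper_c0 D \<Longrightarrow>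
      length (g s) = length s \<and> (\<forall>a\<in>set (g s). \<bar>a\<bar> \<le> 1) \<and> D < norm (lincomb (g s) s)"
    for s :: "'x list" by metis
  define f where "f s = (1 / D) *\<^sub>R lincomb (g s) s" for s
  have "map f ss \<in> upper_c0 D \<and> (\<forall>s\<in>set ss. f s \<in> span (set s) \<and> f s \<noteq> 0)"
    if ss: "concat ss \<in> upper_c0 (D\<^sup>2)" "\<forall>s\<in>set ss. s \<notin> upper_c0 D" for ss
  proof -
    have gs: "length (g s) = length s" "\<forall>a\<in>set (g s). \<bar>a\<bar> \<le> 1" "D < norm (lincomb (g s) s)"
      if "s \<in> set ss" for s
      using g[of s] ss that by (auto simp: upper_c0_def)
    have "1 \<le> norm (f s)" if "s \<in> set ss" for s
      using gs(3)[OF that] \<open>D > 0\<close> by (simp add: f_def field_simps)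
    moreover have low: "norm (lincomb bs (map f ss)) \<le> D"
      if bs: "length bs = length ss" "\<forall>b\<in>set bs. \<bar>b\<bar> \<le> 1" for bs
    proof -
      note blocks = lincomb_blocks[OF bs(1), of g]
      have len: "\<forall>s\<in>set ss. length (g s) = length s" using gs(1) by blast
      have "lincomb bs (map f ss) = (1 / D) *\<^sub>R lincomb bs (map (\<lambda>s. lincomb (g s) s) ss)"
        unfolding lincomb_scale_right[symmetric] map_map by (simp only: f_def[abs_def] o_def)
      moreover have "norm (lincomb bs (map (\<lambda>s. lincomb (g s) s) ss)) \<le> D\<^sup>2"
        unfolding blocks(2)[OF len, symmetric] using ss(1) blocks(1)[OF len] blocks(4)[OF len bs(2)] gs(2)
        unfolding upper_c0_def by blast
      ultimately show ?thesis using \<open>D > 0\<close> by (simp add: power2_eq_square pos_divide_le_eq)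
    qed
    ultimately show ?thesis
      unfolding upper_c0_def by (force simp: f_def intro!: span_scale lincomb_in_span)
  qed
  then show ?thesis unfolding blocks_into_def by blast
qed

lemma lp_norm_1: "lp_norm 1 as = sum_abs as"
proof -
  have "0 \<le> sum_abs as" by (rule sum_list_nonneg) auto
  then show ?thesis by (simp add: lp_norm_def)
qed

lemma Tp_1_eq: "Tp 1 K = lower_l1 K"
proof -
  have "norm (lincomb as xs) \<le> 1"
    if "\<forall>x\<in>set xs. norm x \<le> 1" "length as = length xs" "sum_abs as = 1" for as and xs :: "'a list"
    using norm_lincomb_le_sum_abs[OF that(1,2)] that(3) by simp
  then show ?thesis
    unfolding Tp_def lower_l1_def lp_norm_1
    by (auto simp: lincomb_conv_sum[symmetric] inverse_eq_divide)
qed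

lemma lp_norm_infinity_eq_1:
  "lp_norm \<infinity> as = 1 \<longleftrightarrow> (\<forall>a\<in>set as. \<bar>a\<bar> \<le> 1) \<and> (\<exists>a\<in>set as. \<bar>a\<bar> = 1)"
proof -
  have "Max (insert 0 (abs ` set as)) = 1 \<longleftrightarrow>
      1 \<in> insert 0 (abs ` set as) \<and> (\<forall>b\<in>insert 0 (abs ` set as). b \<le> (1 :: real))"
    by (rule Max_eq_iff) simp_all
  also have "\<dots> \<longleftrightarrow> (\<forall>a\<in>set as. \<bar>a\<bar> \<le> 1) \<and> (\<exists>a\<in>set as. \<bar>a\<bar> = 1)"
    unfolding image_iff insert_iff ball_simps by (metis zero_le_one zero_neq_one)
  finally show ?thesis by (simp add: lp_norm_def)
qed

lemma Tp_infinity_iff: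
  "xs \<in> Tp \<infinity> K \<longleftrightarrow> (\<forall>x\<in>set xs. norm x \<le> 1) \<and>
    (\<forall>as. length as = length xs \<longrightarrow> (\<forall>a\<in>set as. \<bar>a\<bar> \<le> 1) \<longrightarrow> (\<exists>a\<in>set as. \<bar>a\<bar> = 1) \<longrightarrow>
      1 / K \<le> norm (lincomb as xs) \<and> norm (lincomb as xs) \<le> 1)"
  unfolding Tp_def lp_norm_infinity_eq_1
  by (auto simp: lincomb_conv_sum[symmetric] inverse_eq_divide)

text \<open>
  Unit vectors as coefficients; this is how the norms of the single vectors are read off from
  an estimate for linear combinations.
\<close>

lemma single_lincomb:
  assumes "x \<in> set xs"
  shows "\<exists>as. length as = length xs \<and> lincomb as xs = x \<and> (\<forall>a\<in>set as. \<bar>a\<bar> \<le> 1) \<and> (\<exists>a\<in>set as. \<bar>a\<bar> = 1)"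
proof -
  have "subseq [x] xs" using assms by (simp add: subseq_singleton_left)
  from subseq_lincomb[OF this, of "[1]"] obtain as where as: "length as = length xs" "lincomb as xs = x"
    "sum_abs as = 1" "set as \<subseteq> {0, 1}" by auto
  moreover have "\<exists>a\<in>set as. \<bar>a\<bar> = 1"
  proof (rule ccontr)
    assume "\<not> ?thesis"
    then have "\<forall>a\<in>set as. \<bar>a\<bar> = 0" using as(4) by fastforce
    then have "sum_abs as = 0" by (induction as) auto
    then show False using as(3) by simp
  qed
  moreover have "\<forall>a\<in>set as. \<bar>a\<bar> \<le> 1" using as(4) by fastforce
  ultimately show ?thesis by blast
qed

lemma Tp_infinity_imp_upper_c0:
  assumes "K > 0" "xs \<in> Tp \<infinity> K"
  shows "map (scaleR K) xs \<in> upper_c0 K"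
proof -
  have "1 \<le> norm (K *\<^sub>R x)" if "x \<in> set xs" for x
  proof -
    have "1 / K \<le> norm x" using single_lincomb[OF that] assms(2) unfolding Tp_infinity_iff by metis
    then show ?thesis using \<open>K > 0\<close> by (simp add: field_simps)
  qed
  moreover have "norm (lincomb as (map (scaleR K) xs)) \<le> K"
    if as: "length as = length xs" "\<forall>a\<in>set as. \<bar>a\<bar> \<le> 1" for as
  proof -
    have "norm (lincomb as xs) \<le> 1"
    proof (cases "\<forall>a\<in>set as. a = 0")
      case True
      have "lincomb as xs = 0" using as(1) True by (induction as xs rule: list_induct2) auto
      then show ?thesis by simp
    next
      case False
      define m where "m = Max (abs ` set as)"
      have le: "\<bar>a\<bar> \<le> m" if "a \<in> set as" for a using that by (simp add: m_def)
      have "m \<in> abs ` set as" unfolding m_def using False by (intro Max_in) auto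
      moreover have "m > 0" using False le by fastforce
      ultimately have "\<forall>a\<in>set (map ((*) (1 / m)) as). \<bar>a\<bar> \<le> 1"
        "\<exists>a\<in>set (map ((*) (1 / m)) as). \<bar>a\<bar> = 1"
        using le by (auto simp: abs_mult)
      then have "norm (lincomb (map ((*) (1 / m)) as) xs) \<le> 1"
        using assms(2) as(1) unfolding Tp_infinity_iff by (metis length_map)
      then have "norm (lincomb as xs) \<le> m"
        unfolding lincomb_scale_left using \<open>m > 0\<close> by (simp add: field_simps)
      also have "m \<le> 1" using \<open>m \<in> abs ` set as\<close> as(2) by auto
      finally show ?thesis .
    qed
    then show ?thesis using \<open>K > 0\<close> unfolding lincomb_scale_right by simp
  qed
  ultimately show ?thesis by (simp add: upper_c0_def)
qed

lemma subseq_closed_Tp_infinity: "subseq_closed (Tp \<infinity> K)"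
  unfolding subseq_closed_def
proof (intro ballI allI impI)
  fix xs ys :: "'a list" assume *: "xs \<in> Tp \<infinity> K" "subseq ys xs"
  note xs = *(1)[unfolded Tp_infinity_iff]
  have "1 / K \<le> norm (lincomb as ys) \<and> norm (lincomb as ys) \<le> 1"
    if as: "length as = length ys" "\<forall>a\<in>set as. \<bar>a\<bar> \<le> 1" "\<exists>a\<in>set as. \<bar>a\<bar> = 1" for as
  proof -
    obtain bs where bs: "length bs = length xs" "lincomb bs xs = lincomb as ys"
      "set as \<subseteq> set bs" "set bs \<subseteq> insert 0 (set as)"
      using subseq_lincomb[OF *(2) as(1)] by (elim exE conjE) (rule that)
    have "\<bar>b\<bar> \<le> 1" if "b \<in> set bs" for b
      using subsetD[OF bs(4) that] as(2) by auto
    moreover have "\<exists>b\<in>set bs. \<bar>b\<bar> = 1" using as(3) bs(3) by blast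
    ultimately have "1 / K \<le> norm (lincomb bs xs) \<and> norm (lincomb bs xs) \<le> 1"
      using xs bs(1) by simp
    then show ?thesis by (simp only: bs(2))
  qed
  moreover have "\<forall>x\<in>set ys. norm x \<le> 1" using xs set_subseq_mono[OF *(2)] by blast
  ultimately show "ys \<in> Tp \<infinity> K" unfolding Tp_infinity_iff by blast
qed

lemma subseq_closed_Tp: "p \<in> {1, \<infinity>} \<Longrightarrow> subseq_closed (Tp p K)"
  using subseq_closed_Tp_infinity subseq_closed_lower_l1 by (auto simp: Tp_1_eq)

text \<open>
  An upper \<open>c\<^sub>0\<close>-estimate contains a lower one: if the coefficient \<open>a\<close> of \<open>x\<close> has modulus \<open>1\<close>, changing
  the signs of all other coefficients gives a combination of norm at most \<open>C\<close>, and the sum of the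
  two combinations is \<open>2 a x\<close>, of norm at least \<open>2\<close>.
\<close>

lemma upper_c0_lower_bound:
  fixes xs :: "'x::real_normed_vector list"
  assumes "xs \<in> upper_c0 C" "length as = length xs" "\<forall>a\<in>set as. \<bar>a\<bar> \<le> 1" "\<exists>a\<in>set as. \<bar>a\<bar> = 1"
  shows "2 - C \<le> norm (lincomb as xs)"
proof -
  from assms(4) obtain a us vs where as: "as = us @ a # vs" and a: "\<bar>a\<bar> = 1"
    by (metis split_list)
  define ys where "ys = take (length us) xs"
  define zs where "zs = drop (Suc (length us)) xs"
  define x where "x = xs ! length us"
  have xs: "xs = ys @ x # zs"
    unfolding ys_def zs_def x_def using assms(2) by (intro id_take_nth_drop) (simp add: as)
  have len: "length ys = length us" "length zs = length vs"
    using assms(2) by (simp_all add: as ys_def zs_def)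
  define bs where "bs = map uminus us @ a # map uminus vs"
  have neg: "lincomb (map uminus cs) ws = - lincomb cs ws" for cs and ws :: "'x list"
    by (induction cs ws rule: list_induct2') simp_all
  have "length bs = length xs" "\<forall>b\<in>set bs. \<bar>b\<bar> \<le> 1"
    using assms(2,3) by (auto simp: bs_def as)
  then have "norm (lincomb bs xs) \<le> C" using assms(1) unfolding upper_c0_def by simp
  moreover have eq: "lincomb as xs + lincomb bs xs = 2 *\<^sub>R (a *\<^sub>R x)"
    using len by (simp add: as bs_def xs neg scaleR_2 scaleR_add_left[symmetric])
  moreover have "x \<in> set xs" by (simp add: xs)
  then have "1 \<le> norm x" using assms(1) unfolding upper_c0_def by simp
  moreover have "norm (lincomb as xs + lincomb bs xs) = 2 * norm x"
    unfolding eq norm_scaleR a by simp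
  ultimately show ?thesis
    using norm_triangle_ineq[of "lincomb as xs" "lincomb bs xs"] by linarith
qed

text \<open>
  The value of \<open>C\<close> solves \<open>(2 - C) / C = 1 / K\<close>, where the left side is the lower constant after
  normalization by \<open>C\<close>.
\<close>

lemma upper_c0_imp_Tp_infinity:
  assumes "K > 1" "C = 2 * K / (K + 1)" "xs \<in> upper_c0 C"
  shows "map (scaleR (1 / C)) xs \<in> Tp \<infinity> K"
proof -
  have "C > 0" using assms(1,2) by simp
  have "2 - C = 2 / (K + 1)" using assms(1) by (simp add: assms(2) field_simps)
  moreover have "C / K = 2 / (K + 1)" using assms(1) by (simp add: assms(2))
  ultimately have "C / K = 2 - C" by simp
  then have K: "1 / K = (2 - C) / C" using \<open>C > 0\<close> \<open>K > 1\<close> by (simp add: field_simps)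
  have "norm x \<le> C" if "x \<in> set xs" for x
  proof -
    from single_lincomb[OF that] obtain as
      where as: "length as = length xs" "lincomb as xs = x" "\<forall>a\<in>set as. \<bar>a\<bar> \<le> 1" by blast
    have "norm (lincomb as xs) \<le> C" using as(1,3) assms(3) unfolding upper_c0_def by blast
    then show ?thesis by (simp only: as(2))
  qed
  moreover have "1 / K \<le> norm (lincomb as xs) / C \<and> norm (lincomb as xs) / C \<le> 1"
    if "length as = length xs" "\<forall>a\<in>set as. \<bar>a\<bar> \<le> 1" "\<exists>a\<in>set as. \<bar>a\<bar> = 1" for as
    unfolding K using upper_c0_lower_bound[OF assms(3) that] that assms(3) \<open>C > 0\<close>
    by (auto simp: upper_c0_def divide_right_mono)
  ultimately show ?thesis
    using \<open>C > 0\<close> unfolding Tp_infinity_iff lincomb_scale_right by simp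
qed

text \<open>
  Square roots are taken \<open>n\<close> times, with \<open>n\<close> so large that \<open>K\<close> is at most the \<open>2^n\<close>-th power of \<open>C\<close>.
\<close>

lemma largeness_improves_constant:
  fixes V :: "real \<Rightarrow> 'x::real_normed_vector list set"
  assumes L: "stable_largeness L"
    and mono: "\<And>C D. 0 < C \<Longrightarrow> C \<le> D \<Longrightarrow> V C \<subseteq> V D"
    and closed: "\<And>C. subseq_closed (V C)"
    and nil: "\<And>C. 0 < C \<Longrightarrow> [] \<in> V C"
    and blocking: "\<And>D. D > 0 \<Longrightarrow> \<exists>f. blocks_into f (V (D\<^sup>2)) (V D)"
    and "K > 0" "C > 1" "L (V K)"
  shows "L (V C)"
proof -
  have enlarge: "L B" if "A \<subseteq> B" "L A" for A B
  proof -
    have "map (scaleR 1) xs = xs" for xs :: "'x list" by (simp add: map_idI)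
    then have "map (scaleR 1) ` A \<subseteq> B" using that(1) by auto
    then show ?thesis using L that(2) unfolding stable_largeness_def by (metis zero_neq_one)
  qed
  have "L (V (C ^ 2 ^ n)) \<Longrightarrow> L (V C)" for n
  proof (induction n)
    case (Suc n)
    have pos: "0 < C ^ 2 ^ n" using \<open>C > 1\<close> by simp
    have "L (V ((C ^ 2 ^ n)\<^sup>2))" using Suc.prems by (simp only: power_mult[symmetric] power_Suc mult.commute)
    then have "L (V (C ^ 2 ^ n))"
      using blocking[OF pos] closed nil[OF pos] L unfolding stable_largeness_def by blast
    then show ?case by (rule Suc.IH)
  qed simp
  moreover obtain n where "K < C ^ n" using \<open>C > 1\<close> real_arch_pow by blast
  then have "K \<le> C ^ 2 ^ n"
    using power_increasing[of n "2 ^ n" C] \<open>C > 1\<close> less_exp[of n] by linarith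
  then have "L (V (C ^ 2 ^ n))" using enlarge mono \<open>K > 0\<close> \<open>L (V K)\<close> by blast
  ultimately show ?thesis by blast
qed

text \<open>
  For \<open>p = \<infinity>\<close> the passage from \<open>T\<^sub>p\<close> to \<open>upper_c0\<close> keeps the constant, and the passage back worsens it
  by a factor near \<open>1\<close> only if it is near \<open>1\<close>; so the way back is taken once the constant has been
  improved sufficiently.
\<close>

theorem Tp_distortion:
  assumes L: "stable_largeness L" and p: "p \<in> {1, \<infinity>}"
    and "K > 1" "L (Tp p K)" "K' > 1"
  shows "L (Tp p K' :: 'x::real_normed_vector list set)"
proof (cases "p = 1")
  case True
  have "L (lower_l1 K')"
  proof (rule largeness_improves_constant[where V = lower_l1, OF L])
    show "lower_l1 C \<subseteq> (lower_l1 D :: 'x list set)" if "0 < C" "C \<le> D" for C D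
    proof -
      have "1 / D \<le> 1 / C" using that by (simp add: frac_le)
      then show ?thesis unfolding lower_l1_def by (auto intro: order_trans)
    qed
    show "L (lower_l1 K)" using assms True by (simp add: Tp_1_eq)
      show "[] \<in> lower_l1 C" for C by (simp add: lower_l1_def)
  qed (use \<open>K > 1\<close> \<open>K' > 1\<close> in \<open>auto intro: subseq_closed_lower_l1 lower_l1_blocking\<close>)
  then show ?thesis by (simp add: True Tp_1_eq)
next
  case False
  then have p: "p = \<infinity>" using p by auto
  define C where "C = 2 * K' / (K' + 1)"
  have "C > 1" using \<open>K' > 1\<close> by (simp add: C_def)
  have "L (upper_c0 C)"
  proof (rule largeness_improves_constant[where V = upper_c0, OF L])
    show "upper_c0 C \<subseteq> (upper_c0 D :: 'x list set)" if "C \<le> D" for C D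
      using that unfolding upper_c0_def by (auto intro: order_trans)
    have "map (scaleR K) ` Tp p K \<subseteq> upper_c0 K"
      using Tp_infinity_imp_upper_c0[of K] \<open>K > 1\<close> by (auto simp: p)
    moreover have "K \<noteq> 0" using \<open>K > 1\<close> by simp
    ultimately show "L (upper_c0 K)" using L \<open>L (Tp p K)\<close> unfolding stable_largeness_def by blast
      show "[] \<in> upper_c0 C" if "0 < C" for C using that by (simp add: upper_c0_def)
  qed (use \<open>K > 1\<close> \<open>C > 1\<close> in \<open>auto intro: subseq_closed_upper_c0 upper_c0_blocking\<close>)
  moreover have "map (scaleR (1 / C)) ` upper_c0 C \<subseteq> Tp p K'"
    using upper_c0_imp_Tp_infinity[OF \<open>K' > 1\<close> C_def] by (auto simp: p)
  moreover have "1 / C \<noteq> 0" using \<open>C > 1\<close> by simp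
  ultimately show ?thesis using L unfolding stable_largeness_def by blast
qed

section \<open>Derivatives of sets of sequences\<close>

lemma iter_deriv_0 [simp]: "iter_deriv D T 0 = T"
  by (simp add: iter_deriv_def orec_0)

lemma iter_deriv_osucc: "iter_deriv D T (osucc \<xi>) = D (iter_deriv D T \<xi>)"
  by (simp add: iter_deriv_def orec_osucc)

lemma iter_deriv_limit:
  "limit_ordinal \<xi> \<Longrightarrow> iter_deriv D T \<xi> = (\<Inter>\<zeta>\<in>{..<\<xi>}. iter_deriv D T \<zeta>)"
  unfolding iter_deriv_def by (rule orec_limit) auto

lemma iter_deriv_antimono:
  assumes "\<And>A. D A \<subseteq> A"
  shows "\<alpha> \<le> \<beta> \<Longrightarrow> iter_deriv D T \<beta> \<subseteq> iter_deriv D T \<alpha>"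
proof (induction \<beta> rule: ordinal_induct)
  case (succ \<beta>)
  then show ?case
    using assms[of "iter_deriv D T \<beta>"] by (auto simp: iter_deriv_osucc order_le_less less_osucc_iff)
next
  case (limit \<gamma>)
  then show ?case by (auto simp: iter_deriv_limit order_le_less)
qed simp

lemma less_deriv_order_iff:
  assumes "\<And>A. D A \<subseteq> A"
  shows "Fin \<gamma> < deriv_order D T \<longleftrightarrow> iter_deriv D T (\<gamma> :: 'u ordinal) \<noteq> {}"
proof (cases "\<exists>\<xi> :: 'u ordinal. iter_deriv D T \<xi> = {}")
  case True
  let ?l = "LEAST \<xi> :: 'u ordinal. iter_deriv D T \<xi> = {}"
  have "iter_deriv D T ?l = {}" using True by (rule LeastI_ex)
  then have "\<gamma> < ?l \<longleftrightarrow> iter_deriv D T \<gamma> \<noteq> {}"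
    using iter_deriv_antimono[of D, OF assms, of ?l \<gamma> T] not_less_Least[of \<gamma>] leI by blast
  then show ?thesis using True by (simp add: deriv_order_def)
next
  case False
  then show ?thesis by (simp add: deriv_order_def less_extended_def)
qed

text \<open>
  The common form of the derivatives: with \<open>Y i = UNIV\<close> this is the tree derivative (on sets closed
  under subsequences), with \<open>Y i\<close> the vectors supported on \<open>[i, \<infinity>)\<close> the asymptotic one.
\<close>

definition tail_deriv :: "(nat \<Rightarrow> 'a set) \<Rightarrow> 'a list set \<Rightarrow> 'a list set" where
  "tail_deriv Y T = {t\<in>T. \<forall>i. \<exists>y\<in>Y i. t @ [y] \<in> T}"

lemma tail_deriv_iff: "t \<in> tail_deriv Y T \<longleftrightarrow> t \<in> T \<and> (\<forall>i. \<exists>y\<in>Y i. t @ [y] \<in> T)"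
  by (simp add: tail_deriv_def)

lemma tail_deriv_subset: "tail_deriv Y T \<subseteq> T"
  by (auto simp: tail_deriv_def)

lemmas iter_tail_deriv_antimono = iter_deriv_antimono[of "tail_deriv _", OF tail_deriv_subset]

text \<open>
  Closure under subsequences replaces closure under initial segments, which need not be inherited
  by asymptotic derivatives. It ensures that a derivative is empty only if it omits the empty
  sequence.
\<close>

lemma subseq_closed_iter_tail_deriv:
  assumes "subseq_closed T"
  shows "subseq_closed (iter_deriv (tail_deriv Y) T \<xi>)"
proof (induction \<xi> rule: ordinal_induct)
  case zero
  then show ?case using assms by simp
next
  case (succ \<xi>)
  have "subseq (s @ [y]) (t @ [y])" if "subseq s t" for s t and y :: 'a
    using that by simp
  then show ?case
    using succ unfolding iter_deriv_osucc tail_deriv_def subseq_closed_def by blast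
next
  case (limit \<xi>)
  then show ?case unfolding iter_deriv_limit[OF limit(1)] subseq_closed_def by blast
qed

lemma subseq_closed_nonempty_iff: "subseq_closed T \<Longrightarrow> T \<noteq> {} \<longleftrightarrow> [] \<in> T"
  by (auto simp: subseq_closed_def)

lemma tree_deriv_eq_tail_deriv:
  assumes "subseq_closed T"
  shows "tree_deriv T = tail_deriv (\<lambda>_. UNIV) T"
proof -
  have "(\<exists>s\<in>T. strict_prefix t s) \<longleftrightarrow> (\<exists>y. t @ [y] \<in> T)" for t
  proof
    assume "\<exists>s\<in>T. strict_prefix t s"
    then obtain y us where "t @ y # us \<in> T" by (auto elim: strict_prefixE')
    moreover have "subseq (t @ [y]) (t @ y # us)" by (simp add: subseq_append' subseq_singleton_left)
    ultimately show "\<exists>y. t @ [y] \<in> T" using assms unfolding subseq_closed_def by blast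
  next
    assume "\<exists>y. t @ [y] \<in> T"
    then show "\<exists>s\<in>T. strict_prefix t s" by (metis prefix_snoc prefix_order.order_refl append_self_conv not_Cons_self2 strict_prefix_def)
  qed
  then show ?thesis by (simp add: tree_deriv_def tail_deriv_def set_diff_eq) blast
qed

lemma iter_tree_deriv_eq:
  assumes "subseq_closed T"
  shows "iter_deriv tree_deriv T \<xi> = iter_deriv (tail_deriv (\<lambda>_. UNIV)) T \<xi>"
proof (induction \<xi> rule: ordinal_induct)
  case (succ \<xi>)
  then show ?case
    by (simp add: iter_deriv_osucc tree_deriv_eq_tail_deriv subseq_closed_iter_tail_deriv[OF assms])
qed (simp_all add: iter_deriv_limit)

lemma less_tree_order_iff:
  assumes "subseq_closed T"
  shows "Fin \<gamma> < deriv_order tree_deriv T \<longleftrightarrow> iter_deriv (tail_deriv (\<lambda>_. UNIV)) T \<gamma> \<noteq> {}"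
  unfolding iter_tree_deriv_eq[OF assms, symmetric]
  by (rule less_deriv_order_iff) (auto simp: tree_deriv_def)

lemma subseq_closed_Int: "subseq_closed A \<Longrightarrow> subseq_closed B \<Longrightarrow> subseq_closed (A \<inter> B)"
  by (auto simp: subseq_closed_def)

text \<open>
  The restriction on sequences (\<open>Bl\<close>) and on new entries (\<open>Y\<close>) in the three indices. Blocking has to
  respect both: block sequences of block sequences are block sequences, and blocks of vectors in
  \<open>Y i\<close> are in \<open>Y i\<close>.
\<close>

locale block_class =
  fixes Bl :: "'x::real_vector list set" and Y :: "nat \<Rightarrow> 'x set"
  assumes closed: "subseq_closed Bl"
    and blocks: "concat ss \<in> Bl \<Longrightarrow> (\<And>s. s \<in> set ss \<Longrightarrow> f s \<in> span (set s) \<and> f s \<noteq> 0) \<Longrightarrow>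
      map f ss \<in> Bl"
    and scale: "xs \<in> Bl \<Longrightarrow> c \<noteq> 0 \<Longrightarrow> map (scaleR c) xs \<in> Bl"
    and subspace: "subspace (Y i)"
    and antimono: "i \<le> j \<Longrightarrow> Y j \<subseteq> Y i"
begin

abbreviation "der A \<equiv> iter_deriv (tail_deriv Y) (A \<inter> Bl)"

lemma scale_der:
  assumes "map (scaleR c) ` A \<subseteq> B" "c \<noteq> 0"
  shows "xs \<in> der A \<gamma> \<Longrightarrow> map (scaleR c) xs \<in> der B \<gamma>"
proof (induction \<gamma> arbitrary: xs rule: ordinal_induct)
  case zero
  then show ?case using assms scale by auto
next
  case (succ \<gamma>)
  have "\<exists>y\<in>Y i. map (scaleR c) xs @ [y] \<in> der B \<gamma>" for i
  proof -
    obtain y where "y \<in> Y i" "xs @ [y] \<in> der A \<gamma>"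
      using succ.prems unfolding iter_deriv_osucc by (auto simp: tail_deriv_iff)
    then show ?thesis
      using succ.IH[of "xs @ [y]"] subspace_scale[OF subspace]
      by (intro bexI[of _ "c *\<^sub>R y"]) auto
  qed
  then show ?case using succ by (simp add: iter_deriv_osucc tail_deriv_iff)
qed (simp add: iter_deriv_limit)

text \<open>
  If all extensions of \<open>t\<close> within the derivative of order \<open>\<alpha>\<close> were by sequences in \<open>B\<close>, then the \<open>\<beta>\<close>
  derivatives taken at \<open>t\<close> between \<open>\<alpha>\<close> and \<open>\<alpha> + \<beta>\<close> would be derivatives of \<open>B\<close>, and the \<open>\<beta>\<close>-th of
  those would not be empty.
\<close>

lemma extension_outside:
  assumes B: "[] \<notin> der B \<beta>" and t: "t \<in> der A (\<alpha> + \<beta>)"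
  shows "\<exists>s. set s \<subseteq> Y i \<and> t @ s \<in> der A \<alpha> \<and> s \<notin> B"
proof (rule ccontr)
  assume "\<not> ?thesis"
  then have inB: "s \<in> B" if "set s \<subseteq> Y i" "t @ s \<in> der A \<alpha>" for s using that by blast
  have "s \<in> der B \<delta>" if "set s \<subseteq> Y i" "t @ s \<in> der A (\<alpha> + \<delta>)" for s \<delta>
    using that
  proof (induction \<delta> arbitrary: s rule: ordinal_induct)
    case zero
    have "t @ s \<in> A \<inter> Bl"
      using zero iter_tail_deriv_antimono[of 0 \<alpha> Y "A \<inter> Bl"] by auto
    moreover have "subseq s (t @ s)" by (simp add: list_emb_append2)
    ultimately have "s \<in> Bl" using closed unfolding subseq_closed_def by blast
    then show ?case using inB zero by simp
  next
    case (succ \<delta>)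
    have tail: "t @ s \<in> tail_deriv Y (der A (\<alpha> + \<delta>))"
      using succ.prems by (simp add: ordinal_add_osucc iter_deriv_osucc)
    have "\<exists>y\<in>Y j. s @ [y] \<in> der B \<delta>" for j
    proof -
      obtain y where y: "y \<in> Y (max i j)" "t @ s @ [y] \<in> der A (\<alpha> + \<delta>)"
        using tail by (auto simp: tail_deriv_iff)
      then have "y \<in> Y i" "y \<in> Y j" using antimono by (meson max.cobounded1 max.cobounded2 subsetD)+
      then show ?thesis using succ.IH[of "s @ [y]"] succ.prems y by auto
    qed
    moreover have "s \<in> der B \<delta>" using succ tail by (simp add: tail_deriv_iff)
    ultimately show ?case by (simp add: iter_deriv_osucc tail_deriv_iff)
  next
    case (limit \<gamma>)
    have "s \<in> der B \<delta>" if "\<delta> < \<gamma>" for \<delta>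
    proof -
      have "\<alpha> + \<delta> \<le> \<alpha> + \<gamma>" using that by (simp add: ordinal_add_le_mono_right)
      then have "t @ s \<in> der A (\<alpha> + \<delta>)"
        by (rule subsetD[OF iter_tail_deriv_antimono limit.prems(2)])
      then show ?thesis by (rule limit.IH[OF that limit.prems(1)])
    qed
    then show ?case by (simp add: iter_deriv_limit[OF limit(1)])
  qed
  from this[of "[]" \<beta>] show False using B t by simp
qed

text \<open>
  One derivative of \<open>B\<close> costs \<open>\<beta>\<close> derivatives of \<open>A\<close>: these provide one more segment outside \<open>B\<close>, and
  its block is the required new entry.
\<close>

lemma blocks_der:
  assumes f: "blocks_into f A B" and B: "[] \<notin> der B \<beta>"
  shows "concat ss \<in> der A (\<beta> * \<gamma>) \<Longrightarrow> \<forall>s\<in>set ss. s \<notin> B \<Longrightarrow> map f ss \<in> der B \<gamma>"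
proof (induction \<gamma> arbitrary: ss rule: ordinal_induct)
  case zero
  then have "concat ss \<in> A" "concat ss \<in> Bl" by auto
  then show ?case using f zero(2) blocks by (auto simp: blocks_into_def)
next
  case (succ \<gamma>)
  have prems: "concat ss \<in> der A (\<beta> * \<gamma> + \<beta>)" using succ.prems(1) by (simp add: ordinal_mult_osucc)
  have "\<exists>y\<in>Y i. map f ss @ [y] \<in> der B \<gamma>" for i
  proof -
    obtain s where s: "set s \<subseteq> Y i" "concat ss @ s \<in> der A (\<beta> * \<gamma>)" "s \<notin> B"
      using extension_outside[OF B prems] by blast
    then have "concat (ss @ [s]) \<in> A"
      using iter_tail_deriv_antimono[of 0 "\<beta> * \<gamma>" Y "A \<inter> Bl"] by auto
    moreover have outside: "\<forall>r\<in>set (ss @ [s]). r \<notin> B" using succ.prems(2) s(3) by auto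
    ultimately have "f s \<in> span (set s)"
      using f[unfolded blocks_into_def, rule_format, of "ss @ [s]"] by auto
    then have "f s \<in> Y i" using span_minimal[OF s(1) subspace] by blast
    moreover have "map f (ss @ [s]) \<in> der B \<gamma>"
      using s(2) outside by (intro succ.IH) auto
    ultimately show ?thesis by auto
  qed
  moreover have "map f ss \<in> der B \<gamma>"
    using succ prems iter_tail_deriv_antimono[OF ordinal_le_add_left] by blast
  ultimately show ?case by (simp add: iter_deriv_osucc tail_deriv_iff)
next
  case (limit \<gamma>)
  have "map f ss \<in> der B \<delta>" if "\<delta> < \<gamma>" for \<delta>
  proof -
    have "\<beta> * \<delta> \<le> \<beta> * \<gamma>" using that by (simp add: ordinal_mult_mono_right)
    then have "concat ss \<in> der A (\<beta> * \<delta>)" by (rule subsetD[OF iter_tail_deriv_antimono limit.prems(1)])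
    then show ?thesis by (rule limit.IH[OF that _ limit.prems(2)])
  qed
  then show ?case by (simp add: iter_deriv_limit[OF limit(1)])
qed

lemma stable_largeness_der:
  fixes \<xi> :: "'u ordinal"
  shows "stable_largeness (\<lambda>A. der A (omega_pow (omega_pow \<xi>)) \<noteq> {})"
  unfolding stable_largeness_def
proof (rule conjI; intro allI impI)
  fix A B :: "'x list set" and c :: real
  assume "c \<noteq> 0" "map (scaleR c) ` A \<subseteq> B" "der A (omega_pow (omega_pow \<xi>)) \<noteq> {}"
  then show "der B (omega_pow (omega_pow \<xi>)) \<noteq> {}" using scale_der by blast
next
  fix A B :: "'x list set" and f
  assume AB: "subseq_closed A" "subseq_closed B" and f: "blocks_into f A B"
    and large: "der A (omega_pow (omega_pow \<xi>)) \<noteq> {}"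
  let ?\<Gamma> = "omega_pow (omega_pow \<xi>)"
  have nil_iff: "der C \<gamma> \<noteq> {} \<longleftrightarrow> [] \<in> der C \<gamma>" if "subseq_closed C" for C \<gamma>
    by (intro subseq_closed_nonempty_iff subseq_closed_iter_tail_deriv subseq_closed_Int that closed)
  have "[] \<in> der B \<beta>" if \<beta>: "\<beta> < ?\<Gamma>" for \<beta>
  proof (rule ccontr)
    assume B: "[] \<notin> der B \<beta>"
    have "\<beta> * \<beta> \<le> ?\<Gamma>" using omega_pow_omega_pow_square_closed[OF \<beta>] by simp
    then have "[] \<in> der A (\<beta> * \<beta>)"
      using large nil_iff[OF AB(1)] iter_tail_deriv_antimono by blast
    then show False using blocks_der[OF f B, of "[]" \<beta>] B by simp
  qed
  moreover have "limit_ordinal ?\<Gamma>" by (rule limit_ordinal_omega_pow[OF omega_pow_pos])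
  ultimately have "[] \<in> der B ?\<Gamma>" by (simp add: iter_deriv_limit)
  then show "der B ?\<Gamma> \<noteq> {}" by blast
qed

end

section \<open>Block sequences of an FDD\<close>

lemma sorted_wrt_subseq: "subseq ys xs \<Longrightarrow> sorted_wrt P xs \<Longrightarrow> sorted_wrt P ys"
  by (induction rule: list_emb.induct) (use set_subseq_mono in auto)

context
  fixes E :: "nat \<Rightarrow> 'x::banach set"
  assumes E: "FDD E"
begin

lemma FDD_expansion_proj: "FDD_expansion E (\<lambda>n. FDD_proj E n x) x"
  using theI'[of "\<lambda>y. FDD_expansion E y x"] E unfolding FDD_def FDD_proj_def by simp

lemma FDD_proj_eqI: "FDD_expansion E y x \<Longrightarrow> FDD_proj E n x = y n"
  using E FDD_expansion_proj[of x] unfolding FDD_def by (metis (no_types))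

lemma subspace_FDD: "n \<ge> 1 \<Longrightarrow> subspace (E n)"
proof -
  assume "n \<ge> 1"
  then obtain B where "E n = span B" using E unfolding FDD_def by blast
  then show ?thesis by (simp add: subspace_span)
qed

lemma FDD_proj_0: "FDD_proj E n 0 = 0"
  by (rule FDD_proj_eqI) (auto simp: FDD_expansion_def subspace_0[OF subspace_FDD])

lemma FDD_proj_add: "FDD_proj E n (x + y) = FDD_proj E n x + FDD_proj E n y"
  by (rule FDD_proj_eqI)
    (use FDD_expansion_proj[of x] FDD_expansion_proj[of y] in
      \<open>auto simp: FDD_expansion_def intro: subspace_add[OF subspace_FDD] sums_add\<close>)

lemma FDD_proj_scale: "FDD_proj E n (c *\<^sub>R x) = c *\<^sub>R FDD_proj E n x"
  by (rule FDD_proj_eqI)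
    (use FDD_expansion_proj[of x] in
      \<open>auto simp: FDD_expansion_def intro: subspace_scale[OF subspace_FDD] sums_scaleR_right\<close>)

lemma supp_nonempty: 
  assumes "x \<noteq> 0" shows "supp E x \<noteq> {}"
proof
  assume "supp E x = {}"
  then have "(\<lambda>n. 0) sums x"
    using FDD_expansion_proj[of x] by (auto simp: FDD_expansion_def supp_def)
  then show False using assms sums_0 sums_unique2 by blast
qed

lemma subspace_supp: "subspace {x. supp E x \<subseteq> M}"
proof (rule subspaceI)
  show "x + y \<in> {x. supp E x \<subseteq> M}" if "x \<in> {x. supp E x \<subseteq> M}" "y \<in> {x. supp E x \<subseteq> M}" for x y
    using that by (fastforce simp: supp_def FDD_proj_add)
qed (auto simp: supp_def FDD_proj_0 FDD_proj_scale)

text \<open>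
  The coordinate projections are linear, so the vectors supported in a fixed set form a subspace.
\<close>

lemma supp_span: "y \<in> span S \<Longrightarrow> supp E y \<subseteq> (\<Union>x\<in>S. supp E x)"
  using span_minimal[OF _ subspace_supp, of S "\<Union>x\<in>S. supp E x"] by auto

lemma supp_scale: "c \<noteq> 0 \<Longrightarrow> supp E (c *\<^sub>R x) = supp E x"
  by (simp add: supp_def FDD_proj_scale)

text \<open>
  The relation between successive members of a block sequence. With the conditions of finiteness
  and non-vanishing included it is transitive, so that a condition on neighbours becomes a
  condition on all pairs.
\<close>

definition before :: "'x \<Rightarrow> 'x \<Rightarrow> bool" where
  "before x y \<longleftrightarrow> x \<noteq> 0 \<and> y \<noteq> 0 \<and> finite (supp E x) \<and> finite (supp E y) \<and> Max (supp E x) < Min (supp E y)"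

lemma before_iff:
  "before x y \<longleftrightarrow> x \<noteq> 0 \<and> y \<noteq> 0 \<and> finite (supp E x) \<and> finite (supp E y) \<and>
    (\<forall>m\<in>supp E x. \<forall>n\<in>supp E y. m < n)"
  unfolding before_def using supp_nonempty by (auto simp: Max_less_iff)

lemma transp_before: "transp before"
proof (rule transpI)
  fix x y z assume xyz: "before x y" "before y z"
  have "supp E y \<noteq> {}" using xyz(1) by (intro supp_nonempty) (simp add: before_iff)
  then obtain k where "k \<in> supp E y" by blast
  then have "m < n" if "m \<in> supp E x" "n \<in> supp E z" for m n
    using xyz that unfolding before_iff by (meson order_less_trans)
  then show "before x z" using xyz unfolding before_iff by simp
qed

lemma block_sequences_iff:
  "xs \<in> block_sequences E \<longleftrightarrow> (\<forall>x\<in>set xs. x \<noteq> 0 \<and> finite (supp E x)) \<and> sorted_wrt before xs"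
  unfolding sorted_wrt_iff_nth_Suc_transp[OF transp_before] block_sequences_def before_def by auto

lemma block_class_block_sequences:
  "block_class (block_sequences E) (\<lambda>i. {y. \<forall>j\<in>supp E y. i \<le> j})"
    and block_class_block_sequences_UNIV: "block_class (block_sequences E) (\<lambda>_. UNIV)"
proof -
  have 1: "subseq_closed (block_sequences E)"
    unfolding subseq_closed_def
  proof (intro ballI allI impI)
    fix xs ys assume "xs \<in> block_sequences E" and sub: "subseq ys xs"
    then show "ys \<in> block_sequences E"
      unfolding block_sequences_iff using set_subseq_mono[OF sub] sorted_wrt_subseq[OF sub] by blast
  qed
  have 2: "map f ss \<in> block_sequences E"
    if "concat ss \<in> block_sequences E" "\<And>s. s \<in> set ss \<Longrightarrow> f s \<in> span (set s) \<and> f s \<noteq> 0"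
    for f ss
    using that
  proof (induction ss)
    case (Cons s ss)
    have fs: "finite (supp E (f s))" "f s \<noteq> 0"
      using Cons.prems finite_subset[OF supp_span[of "f s" "set s"]] by (auto simp: block_sequences_iff)
    moreover have IH: "map f ss \<in> block_sequences E"
      using Cons by (auto simp: block_sequences_iff sorted_wrt_append)
    moreover have "before (f s) (f t)" if t: "t \<in> set ss" for t
    proof -
      have less: "m < n" if mn: "m \<in> supp E (f s)" "n \<in> supp E (f t)" for m n
      proof -
        obtain x where x: "x \<in> set s" "m \<in> supp E x"
          using mn(1) Cons.prems(2)[of s] supp_span[of "f s" "set s"] by auto
        obtain y where y: "y \<in> set t" "n \<in> supp E y"
          using mn(2) t Cons.prems(2)[of t] supp_span[of "f t" "set t"] by auto
        have "before x y"
          using Cons.prems(1) t x(1) y(1) by (auto simp: block_sequences_iff sorted_wrt_append)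
        then show ?thesis using x(2) y(2) by (simp add: before_iff)
      qed
      have "f t \<noteq> 0" "finite (supp E (f t))"
        using IH t by (auto simp: block_sequences_iff)
      then show ?thesis using fs less by (simp add: before_iff)
    qed
    ultimately show ?case by (auto simp: block_sequences_iff)
  qed (simp add: block_sequences_iff)
  have 3: "map (scaleR c) xs \<in> block_sequences E" if "xs \<in> block_sequences E" "c \<noteq> 0" for c xs
    using that by (auto simp: block_sequences_def supp_scale)
  have "{y. \<forall>j\<in>supp E y. i \<le> j} = {y. supp E y \<subseteq> {i..}}" for i by auto
  then have 4: "subspace {y. \<forall>j\<in>supp E y. i \<le> j}" for i using subspace_supp by simp
  show "block_class (block_sequences E) (\<lambda>i. {y. \<forall>j\<in>supp E y. i \<le> j})"
    by unfold_locales (use 1 2 3 4 in auto)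
  show "block_class (block_sequences E) (\<lambda>_. UNIV)"
    by unfold_locales (use 1 2 3 in auto)
qed

end

lemma FDD_deriv_eq_tail_deriv: "FDD_deriv E = tail_deriv (\<lambda>i. {y. \<forall>j\<in>supp E y. i \<le> j})"
proof (rule ext)
  fix T
  have "(\<exists>y. \<forall>i\<ge>1. (\<forall>j\<in>supp E (y i). i \<le> j) \<and> xs @ [y i] \<in> T) \<longleftrightarrow>
      (\<forall>i. \<exists>y. (\<forall>j\<in>supp E y. i \<le> j) \<and> xs @ [y] \<in> T)" (is "?L \<longleftrightarrow> ?R") for xs
  proof
    assume ?L
    then obtain y where y: "\<forall>i\<ge>1. (\<forall>j\<in>supp E (y i). i \<le> j) \<and> xs @ [y i] \<in> T" by blast
    show ?R
    proof
      fix i :: nat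
      show "\<exists>y. (\<forall>j\<in>supp E y. i \<le> j) \<and> xs @ [y] \<in> T"
        using y[rule_format, of "Suc i"] by (intro exI[of _ "y (Suc i)"]) auto
    qed
  next
    assume ?R
    then show ?L by metis
  qed
  then show "FDD_deriv E T = tail_deriv (\<lambda>i. {y. \<forall>j\<in>supp E y. i \<le> j}) T"
    by (simp add: FDD_deriv_def tail_deriv_def)
qed

lemma block_class_UNIV: "block_class UNIV (\<lambda>_. UNIV)"
  by unfold_locales (auto simp: subseq_closed_def)

section \<open>Largeness along a family of finite sets\<close>

text \<open>
  The spreading property of the literature, for the maps that come from passing to a subsequence.
\<close>

definition spreading :: "nat set set \<Rightarrow> bool" where
  "spreading F \<longleftrightarrow> (\<forall>E\<in>F. \<forall>M :: nat \<Rightarrow> nat. strict_mono M \<longrightarrow> M ` E \<in> F)"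

definition block_map :: "nat set set \<Rightarrow> (nat \<Rightarrow> nat) \<Rightarrow> nat set \<Rightarrow> (nat \<Rightarrow> nat set) \<Rightarrow> bool" where
  "block_map G h F s \<longleftrightarrow>
     (\<forall>j\<in>F. s j \<in> G \<and> s j \<noteq> {} \<and> h j \<le> Min (s j)) \<and>
     (\<forall>i\<in>F. \<forall>j\<in>F. i < j \<longrightarrow> Max (s i) < Min (s j))"

definition absorbs :: "nat set set \<Rightarrow> nat set set \<Rightarrow> nat set set \<Rightarrow> (nat \<Rightarrow> nat) \<Rightarrow> bool" where
  "absorbs H F G h \<longleftrightarrow> (\<forall>A\<in>F. \<forall>s. block_map G h A s \<longrightarrow> (\<Union>j\<in>A. s j) \<in> H)"

text \<open>
  The families \<open>G k\<close> exhaust \<open>F\<close> as the approximating families exhaust a Schreier family of limit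
  order. They are small compared to \<open>F\<close>: sparse unions of members of one \<open>G k\<close>, over index sets in \<open>F\<close>,
  stay in \<open>F\<close>.
\<close>

definition self_absorbing :: "nat set set \<Rightarrow> bool" where
  "self_absorbing F \<longleftrightarrow> F \<subseteq> fin_sets \<and> (\<exists>G :: nat \<Rightarrow> nat set set.
     (\<forall>k\<ge>1. G k \<subseteq> fin_sets \<and> spreading (G k) \<and> (\<exists>h. absorbs F F (G k) h)) \<and>
     (\<forall>E\<in>F. \<exists>k\<ge>1. (\<forall>m\<in>E. k \<le> m) \<and> E \<in> G k))"

definition spread_in :: "nat set set \<Rightarrow> 'x list set \<Rightarrow> bool" where
  "spread_in F A \<longleftrightarrow> (\<exists>x :: nat \<Rightarrow> 'x. \<forall>E\<in>F. map x (sorted_list_of_set E) \<in> A)"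

lemma sorted_list_of_set_image:
  assumes "strict_mono (M :: nat \<Rightarrow> nat)" "finite E"
  shows "sorted_list_of_set (M ` E) = map M (sorted_list_of_set E)"
proof (rule strict_sorted_equal)
  show "sorted_wrt (<) (map M (sorted_list_of_set E))"
    unfolding sorted_wrt_map
    by (rule sorted_wrt_mono_rel[OF _ strict_sorted_list_of_set]) (simp add: strict_mono_less[OF assms(1)])
qed (use assms in auto)

lemma sorted_concat_blocks:
  fixes s :: "nat \<Rightarrow> nat set"
  assumes "sorted_wrt (<) js" "\<forall>j\<in>set js. finite (s j)"
    "\<forall>i\<in>set js. \<forall>j\<in>set js. i < j \<longrightarrow> (\<forall>a\<in>s i. \<forall>b\<in>s j. a < b)"
  shows "sorted_wrt (<) (concat (map (\<lambda>j. sorted_list_of_set (s j)) js))"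
  using assms
proof (induction js)
  case (Cons j js)
  have "a < b" if "a \<in> s j" "i \<in> set js" "b \<in> s i" for a b i
    using Cons.prems(1) Cons.prems(3)[rule_format, of j i a b] that by simp
  moreover have "sorted_wrt (<) (concat (map (\<lambda>j. sorted_list_of_set (s j)) js))"
  proof (rule Cons.IH)
    show "sorted_wrt (<) js" using Cons.prems(1) by simp
    show "\<forall>j\<in>set js. finite (s j)" using Cons.prems(2) by simp
    show "\<forall>i\<in>set js. \<forall>j\<in>set js. i < j \<longrightarrow> (\<forall>a\<in>s i. \<forall>b\<in>s j. a < b)"
      using Cons.prems(3) by (meson list.set_intros(2))
  qed
  ultimately show ?case
    using Cons.prems(2) by (auto simp: sorted_wrt_append strict_sorted_list_of_set)
qed simp

lemma sorted_list_of_set_UN: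
  assumes s: "block_map G h F s" and "G \<subseteq> fin_sets" "finite F"
  shows "sorted_list_of_set (\<Union>j\<in>F. s j) =
    concat (map (\<lambda>j. sorted_list_of_set (s j)) (sorted_list_of_set F))"
proof (rule strict_sorted_equal)
  have fin: "finite (s j)" "s j \<noteq> {}" if "j \<in> F" for j
    using s that \<open>G \<subseteq> fin_sets\<close> by (auto simp: block_map_def fin_sets_def)
  have sep: "a < b" if "i \<in> F" "j \<in> F" "i < j" "a \<in> s i" "b \<in> s j" for i j a b
  proof -
    have "a \<le> Max (s i)" "Min (s j) \<le> b" using that fin by auto
    moreover have "Max (s i) < Min (s j)" using s that by (simp add: block_map_def)
    ultimately show ?thesis by linarith
  qed
  have F: "set (sorted_list_of_set F) = F" using \<open>finite F\<close> by simp
  show "sorted_wrt (<) (concat (map (\<lambda>j. sorted_list_of_set (s j)) (sorted_list_of_set F)))"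
  proof (rule sorted_concat_blocks[OF strict_sorted_list_of_set]; unfold F)
    show "\<forall>j\<in>F. finite (s j)" by (intro ballI fin(1))
    show "\<forall>i\<in>F. \<forall>j\<in>F. i < j \<longrightarrow> (\<forall>a\<in>s i. \<forall>b\<in>s j. a < b)"
      by (intro ballI impI) (rule sep)
  qed
  have "finite (\<Union>j\<in>F. s j)" by (rule finite_UN_I[OF \<open>finite F\<close> fin(1)])
  then show "set (sorted_list_of_set (\<Union>j\<in>F. s j)) =
      set (concat (map (\<lambda>j. sorted_list_of_set (s j)) (sorted_list_of_set F)))"
    using \<open>finite F\<close> fin(1) by simp
qed simp

text \<open>
  If for each \<open>k\<close> the sets in \<open>G k\<close> are eventually good, a subsequence that enters the good region for
  \<open>G 1, \<dots>, G k\<close> at its \<open>k\<close>-th term is good on \<open>F\<close>. Otherwise some \<open>G k\<close> has bad sets arbitrarily far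
  out; a sparse sequence of these is blocked into the new sequence, and self-absorption says that
  the blocks along a set in \<open>F\<close> come from a set in \<open>F\<close>.
\<close>

lemma stable_largeness_spread_in:
  assumes "self_absorbing F"
  shows "stable_largeness (spread_in F :: 'x::real_vector list set \<Rightarrow> bool)"
  unfolding stable_largeness_def
proof (rule conjI; intro allI impI)
  fix A B :: "'x list set" and c :: real
  assume AB: "map (scaleR c) ` A \<subseteq> B" and "spread_in F A"
  then obtain x where "\<forall>E\<in>F. map x (sorted_list_of_set E) \<in> A" by (auto simp: spread_in_def)
  then have "map (\<lambda>n. c *\<^sub>R x n) (sorted_list_of_set E) \<in> B" if "E \<in> F" for E
    using AB that by (fastforce simp: image_subset_iff o_def)
  then show "spread_in F B" unfolding spread_in_def by blast
next
  fix A B :: "'x list set" and f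
  assume nil: "[] \<in> B" and f: "blocks_into f A B" and "spread_in F A"
  then obtain x where x: "map x (sorted_list_of_set E) \<in> A" if "E \<in> F" for E
    by (auto simp: spread_in_def)
  obtain G where F: "F \<subseteq> fin_sets"
    and G: "\<forall>k\<ge>1. G k \<subseteq> fin_sets \<and> spreading (G k) \<and> (\<exists>h. absorbs F F (G k) h)"
    and FG: "\<forall>E\<in>F. \<exists>k\<ge>1. (\<forall>m\<in>E. k \<le> m) \<and> E \<in> G k"
    using assms unfolding self_absorbing_def by (elim conjE exE) (rule that)
  have fin: "finite E" if "E \<in> F" for E using that F by (auto simp: fin_sets_def)
  show "spread_in F B"
  proof (cases "\<forall>k\<ge>1. \<exists>m. \<forall>E\<in>G k. (\<forall>a\<in>E. m \<le> a) \<longrightarrow> map x (sorted_list_of_set E) \<in> B")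
    case True
    then obtain m where m: "\<And>k E. k \<ge> 1 \<Longrightarrow> E \<in> G k \<Longrightarrow> \<forall>a\<in>E. m k \<le> a \<Longrightarrow>
        map x (sorted_list_of_set E) \<in> B" by metis
    \<comment> \<open>a strictly increasing bound for \<open>m 1, \<dots>, m k\<close>; a subsequence must not repeat indices\<close>
    define M where "M k = (\<Sum>i\<le>k. Suc (m i))" for k
    have M: "strict_mono M" by (rule strict_monoI_Suc) (simp add: M_def)
    have le: "m k \<le> M n" if "k \<le> n" for k n
    proof -
      have "Suc (m k) \<le> M n" unfolding M_def using that by (intro member_le_sum) auto
      then show ?thesis by simp
    qed
    have "map (x \<circ> M) (sorted_list_of_set E) \<in> B" if E: "E \<in> F" for E
    proof -
      obtain k where k: "k \<ge> 1" "\<forall>m\<in>E. k \<le> m" "E \<in> G k" using FG E by blast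
      then have "M ` E \<in> G k" using G M unfolding spreading_def by blast
      moreover have "\<forall>a\<in>M ` E. m k \<le> a" using k(2) le by auto
      ultimately have "map x (sorted_list_of_set (M ` E)) \<in> B" using m k(1) by blast
      then show ?thesis by (simp add: sorted_list_of_set_image[OF M fin[OF E]])
    qed
    then show ?thesis unfolding spread_in_def by blast
  next
    case False
    then obtain k where k: "k \<ge> 1"
      and "\<not> (\<exists>m. \<forall>E\<in>G k. (\<forall>a\<in>E. m \<le> a) \<longrightarrow> map x (sorted_list_of_set E) \<in> B)" by auto
    then have bad: "\<exists>E\<in>G k. (\<forall>a\<in>E. m \<le> a) \<and> map x (sorted_list_of_set E) \<notin> B" for m by simp
    have Gk: "G k \<subseteq> fin_sets" using G k by blast
    obtain h where h: "absorbs F F (G k) h" using G k by blast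
    define P where "P n E \<longleftrightarrow> E \<in> G k \<and> E \<noteq> {} \<and> map x (sorted_list_of_set E) \<notin> B \<and> h n \<le> Min E"
      for n E
    have step: "\<exists>E. P n E \<and> l < Min E" for n l
    proof -
      obtain E where E: "E \<in> G k" "\<forall>a\<in>E. max (h n) (Suc l) \<le> a" "map x (sorted_list_of_set E) \<notin> B"
        using bad by blast
      have "E \<noteq> {}" using E(3) nil by auto
      moreover have "finite E" using Gk E(1) by (auto simp: fin_sets_def)
      ultimately have "Min E \<in> E" by simp
      then show ?thesis using E \<open>E \<noteq> {}\<close> unfolding P_def by (auto simp: Suc_le_eq)
    qed
    have "\<exists>s. \<forall>n. P n (s n) \<and> Max (s n) < Min (s (Suc n))"
      by (rule dependent_nat_choice) (use step in blast)+
    then obtain s where s: "\<And>n. P n (s n)" "\<And>n. Max (s n) < Min (s (Suc n))" by blast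
    have "Min (s n) \<le> Min (s (Suc n))" for n
    proof -
      have "Min (s n) \<le> Max (s n)"
        using s(1)[of n] Gk by (intro Min_le Max_in) (auto simp: P_def fin_sets_def)
      also have "\<dots> \<le> Min (s (Suc n))" using s(2)[of n] by simp
      finally show ?thesis .
    qed
    then have mono: "i \<le> j \<Longrightarrow> Min (s i) \<le> Min (s j)" for i j
      by (rule lift_Suc_mono_le[of "\<lambda>n. Min (s n)"])
    have less: "Max (s i) < Min (s j)" if "i < j" for i j
      using s(2)[of i] mono[of "Suc i" j] that by simp
    have "map (\<lambda>n. f (map x (sorted_list_of_set (s n)))) (sorted_list_of_set E) \<in> B" if E: "E \<in> F" for E
    proof -
      have bm: "block_map (G k) h E s" using s(1) less by (auto simp: block_map_def P_def)
      then have "(\<Union>j\<in>E. s j) \<in> F" using h E unfolding absorbs_def by blast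
      from x[OF this] have "concat (map (\<lambda>n. map x (sorted_list_of_set (s n))) (sorted_list_of_set E)) \<in> A"
        by (simp add: sorted_list_of_set_UN[OF bm Gk fin[OF E]] map_concat o_def)
      then have "map f (map (\<lambda>n. map x (sorted_list_of_set (s n))) (sorted_list_of_set E)) \<in> B"
        using f[unfolded blocks_into_def, rule_format, of "map (\<lambda>n. map x (sorted_list_of_set (s n))) (sorted_list_of_set E)"]
          s(1) unfolding P_def by auto
      then show ?thesis by (simp add: o_def)
    qed
    then show ?thesis unfolding spread_in_def by blast
  qed
qed

lemma spread_in_mono_tail:
  assumes "spread_in F A" "spreading F'" "F' \<subseteq> fin_sets"
    "\<And>E. E \<in> F' \<Longrightarrow> \<forall>m\<in>E. n \<le> m \<Longrightarrow> E \<in> F"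
  shows "spread_in F' A"
proof -
  define M where "M k = k + n" for k :: nat
  have M: "strict_mono M" by (simp add: M_def strict_mono_def)
  obtain x where x: "map x (sorted_list_of_set E) \<in> A" if "E \<in> F" for E
    using assms(1) by (auto simp: spread_in_def)
  have "map (x \<circ> M) (sorted_list_of_set E) \<in> A" if "E \<in> F'" for E
  proof -
    have "M ` E \<in> F'" using assms(2) that M by (simp add: spreading_def)
    then have "M ` E \<in> F" by (rule assms(4)) (simp add: M_def)
    moreover have "finite E" using that assms(3) by (auto simp: fin_sets_def)
    ultimately show ?thesis using x[of "M ` E"] by (simp add: sorted_list_of_set_image[OF M])
  qed
  then show ?thesis unfolding spread_in_def by blast
qed

section \<open>Schreier families\<close>

lemma image_fin_sets: "E \<in> fin_sets \<Longrightarrow> strict_mono M \<Longrightarrow> M ` E \<in> fin_sets"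
  using strict_mono_imp_increasing[of M] unfolding fin_sets_def
  by (metis (mono_tags, lifting) finite_imageI imageE le_zero_eq mem_Collect_eq)

lemma schreier_1_image:
  assumes "E \<in> schreier_1" "\<And>n. n \<in> E \<Longrightarrow> n \<le> g n"
  shows "g ` E \<in> schreier_1"
proof (cases "E = {}")
  case False
  have E: "finite E" "0 \<notin> E" "card E \<le> Min E" using assms(1) False by (auto simp: schreier_1_def fin_sets_def)
  have "card E \<le> b" if "b \<in> g ` E" for b
  proof -
    obtain n where "n \<in> E" "b = g n" using \<open>b \<in> g ` E\<close> by blast
    then show ?thesis using E Min_le[of E n] assms(2)[of n] by linarith
  qed
  then have "card (g ` E) \<le> Min (g ` E)"
    using card_image_le[OF E(1), of g] False E(1) by (auto intro: order_trans)
  moreover have "0 \<notin> g ` E" using E(2) assms(2) by (metis imageE le_zero_eq)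
  ultimately show ?thesis using E(1) by (simp add: schreier_1_def fin_sets_def)
qed (simp add: schreier_1_def fin_sets_def)

lemma family_compE:
  assumes "E \<in> family_comp F G"
  obtains "E = {}" | Es where "E = \<Union>(set Es)" "\<And>A. A \<in> set Es \<Longrightarrow> A \<noteq> {} \<and> A \<in> G"
    "\<And>i. Suc i < length Es \<Longrightarrow> Max (Es ! i) < Min (Es ! Suc i)" "Min ` set Es \<in> F"
  using assms unfolding family_comp_def by blast

lemma family_compI:
  assumes "E = \<Union>(set Es)" "\<And>A. A \<in> set Es \<Longrightarrow> A \<noteq> {} \<and> A \<in> G"
    "\<And>i. Suc i < length Es \<Longrightarrow> Max (Es ! i) < Min (Es ! Suc i)" "Min ` set Es \<in> F"
  shows "E \<in> family_comp F G"
  unfolding family_comp_def by (intro insertI2 CollectI exI[of _ Es] conjI ballI allI impI) (use assms in auto)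

lemma spreading_family_comp:
  assumes G: "G \<subseteq> fin_sets" "spreading G"
  shows "spreading (family_comp schreier_1 G)"
  unfolding spreading_def
proof (intro ballI allI impI)
  fix E and M :: "nat \<Rightarrow> nat" assume "E \<in> family_comp schreier_1 G" and M: "strict_mono M"
  from this(1) show "M ` E \<in> family_comp schreier_1 G"
  proof (cases rule: family_compE)
    case (2 Es)
    have fin: "finite A" "A \<noteq> {}" if "A \<in> set Es" for A
      using 2(2)[OF that] G(1) by (auto simp: fin_sets_def)
    have Min: "Min (M ` A) = M (Min A)" and Max: "Max (M ` A) = M (Max A)" if "A \<in> set Es" for A
      using mono_Min_commute[of M A] mono_Max_commute[of M A] fin[OF that] M
      by (simp_all add: strict_mono_mono)
    show ?thesis
    proof (rule family_compI[of _ "map ((`) M) Es"])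
      show "M ` E = \<Union> (set (map ((`) M) Es))" by (auto simp: 2(1))
      show "A \<noteq> {} \<and> A \<in> G" if "A \<in> set (map ((`) M) Es)" for A
        using that 2(2) G(2) M by (auto simp: spreading_def)
      show "Max (map ((`) M) Es ! i) < Min (map ((`) M) Es ! Suc i)"
        if "Suc i < length (map ((`) M) Es)" for i
        using that 2(3)[of i] M by (simp add: Min Max strict_mono_less)
      have "Min ` set (map ((`) M) Es) = M ` Min ` set Es" by (simp add: image_image Min)
      then show "Min ` set (map ((`) M) Es) \<in> schreier_1"
        using schreier_1_image[OF 2(4), of M] strict_mono_imp_increasing[OF M] by simp
    qed
  qed (simp add: family_comp_def)
qed

lemma omega1_pos: "0 < (omega1 :: 'u ordinal)"
proof (rule ccontr)
  assume "\<not> ?thesis"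
  then have "{..<omega1 :: 'u ordinal} = {}" by (auto simp: not_less)
  then show False using uncountable_omega1[where 'u = 'u] by simp
qed

context
  fixes \<phi> :: "'u ordinal \<Rightarrow> nat \<Rightarrow> 'u ordinal"
  assumes \<phi>: "fundamental_system \<phi>"
begin

lemma fundamental_less:
  assumes "limit_ordinal \<xi>" "\<xi> < omega1" "n \<ge> 1"
  shows "osucc (\<phi> \<xi> n) < \<xi>"
proof -
  have inc: "\<phi> \<xi> k < \<phi> \<xi> (Suc k)" if "k \<ge> 1" for k
    using \<phi> assms that unfolding fundamental_system_def by blast
  have "osup (\<phi> \<xi> ` {1..}) \<le> \<xi>" using \<phi> assms unfolding fundamental_system_def by simp
  then have le: "\<phi> \<xi> k \<le> \<xi>" if "k \<ge> 1" for k using that by (subst (asm) countable_le_osup) auto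
  have "osucc (\<phi> \<xi> n) \<le> \<phi> \<xi> (Suc n)" using inc[OF assms(3)] by (simp add: osucc_le_iff)
  also have "\<dots> < \<phi> \<xi> (Suc (Suc n))" by (rule inc) simp
  also have "\<dots> \<le> \<xi>" by (rule le) simp
  finally show ?thesis .
qed

lemma fundamental_cofinal:
  assumes "limit_ordinal \<xi>" "\<xi> < omega1" "\<zeta> < \<xi>"
  shows "\<exists>n\<ge>1. \<zeta> < \<phi> \<xi> n"
proof -
  have "\<zeta> < osup (\<phi> \<xi> ` {1..})" using \<phi> assms unfolding fundamental_system_def by simp
  then show ?thesis by (subst (asm) less_countable_osup) auto
qed

lemma schreier_0: "schreier \<phi> 0 = {E\<in>fin_sets. card E \<le> 1}"
  by (simp add: schreier_def omega1_pos orec_0)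

lemma schreier_osucc:
  "osucc \<xi> < omega1 \<Longrightarrow> schreier \<phi> (osucc \<xi>) = family_comp schreier_1 (schreier \<phi> \<xi>)"
  using order_less_trans[OF osucc_greater, of \<xi> omega1] by (simp add: schreier_def orec_osucc)

lemma schreier_limit:
  assumes "limit_ordinal \<xi>" "\<xi> < omega1"
  shows "schreier \<phi> \<xi> = {E. \<exists>n\<ge>1. (\<forall>m\<in>E. n \<le> m) \<and> E \<in> schreier \<phi> (osucc (\<phi> \<xi> n))}"
proof -
  let ?l = "\<lambda>\<xi> f. {E. \<exists>n\<ge>1. (\<forall>m\<in>E. n \<le> m) \<and> E \<in> f (osucc (\<phi> \<xi> n))}"
  let ?r = "orec {E\<in>fin_sets. card E \<le> 1} (family_comp schreier_1) ?l"
  have less: "osucc (\<phi> \<xi> n) < omega1" if "n \<ge> 1" for n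
    using fundamental_less[OF assms that] assms(2) by simp
  have "?r \<xi> = ?l \<xi> ?r"
    by (rule orec_limit[OF assms(1)]) (use fundamental_less[OF assms] in auto)
  then have "schreier \<phi> \<xi> = ?l \<xi> ?r" using assms(2) by (simp add: schreier_def)
  also have "\<dots> = ?l \<xi> (schreier \<phi>)" using less by (auto simp: schreier_def)
  finally show ?thesis .
qed

lemma schreier_omega1: "omega1 \<le> \<xi> \<Longrightarrow> schreier \<phi> \<xi> = fin_sets"
  unfolding schreier_def by (simp only: not_less[symmetric] if_False)

lemma schreier_induct [consumes 1, case_names zero succ limit]:
  assumes "\<xi> < omega1" "P 0"
    "\<And>\<xi>. osucc \<xi> < omega1 \<Longrightarrow> P \<xi> \<Longrightarrow> P (osucc \<xi>)"
    "\<And>\<xi>. limit_ordinal \<xi> \<Longrightarrow> \<xi> < omega1 \<Longrightarrow> (\<And>\<zeta>. \<zeta> < \<xi> \<Longrightarrow> P \<zeta>) \<Longrightarrow> P \<xi>"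
  shows "P (\<xi> :: 'u ordinal)"
  using assms(1)
proof (induction \<xi> rule: ordinal_induct)
  case (succ \<beta>)
  then show ?case using assms(3) osucc_greater order_less_trans by blast
next
  case (limit \<gamma>)
  then show ?case using assms(4) order_less_trans by blast
qed (rule assms(2))

lemma schreier_subset_fin_sets: "schreier \<phi> \<xi> \<subseteq> fin_sets"
proof (cases "\<xi> < omega1")
  case True
  then show ?thesis
  proof (induction rule: schreier_induct)
    case (succ \<xi>)
    show ?case
    proof
      fix E assume "E \<in> schreier \<phi> (osucc \<xi>)"
      then have "E \<in> family_comp schreier_1 (schreier \<phi> \<xi>)" using succ by (simp add: schreier_osucc)
      then show "E \<in> fin_sets" by (cases rule: family_compE) (use succ in \<open>auto simp: fin_sets_def\<close>)
    qed
  next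
    case (limit \<xi>)
    then show ?case using fundamental_less by (auto simp: schreier_limit)
  qed (auto simp: schreier_0)
qed (simp add: schreier_omega1)

lemma empty_in_schreier: "{} \<in> schreier \<phi> \<xi>"
proof (cases "\<xi> < omega1")
  case True
  then show ?thesis
  proof (induction rule: schreier_induct)
    case (limit \<xi>)
    then show ?case using fundamental_less[of \<xi> 1] by (auto simp: schreier_limit)
  qed (auto simp: schreier_0 schreier_osucc family_comp_def fin_sets_def)
qed (simp add: schreier_omega1 fin_sets_def)

lemma spreading_schreier: "spreading (schreier \<phi> \<xi>)"
proof (cases "\<xi> < omega1")
  case True
  then show ?thesis
  proof (induction rule: schreier_induct)
    case zero
    show ?case
      using image_fin_sets card_image_le
      by (fastforce simp: schreier_0 spreading_def fin_sets_def intro: order_trans)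
  next
    case (succ \<xi>)
    then show ?case by (simp add: schreier_osucc spreading_family_comp schreier_subset_fin_sets)
  next
    case (limit \<xi>)
    show ?case
      unfolding spreading_def schreier_limit[OF limit.hyps]
    proof (intro ballI allI impI CollectI; elim CollectE exE conjE)
      fix E n and M :: "nat \<Rightarrow> nat"
      assume M: "strict_mono M" and n: "1 \<le> n" "\<forall>m\<in>E. n \<le> m" "E \<in> schreier \<phi> (osucc (\<phi> \<xi> n))"
      have "M ` E \<in> schreier \<phi> (osucc (\<phi> \<xi> n))"
        using limit.IH[OF fundamental_less[OF limit.hyps n(1)]] n(3) M by (simp add: spreading_def)
      moreover have "\<forall>m\<in>M ` E. n \<le> m"
        using n(2) strict_mono_imp_increasing[OF M] order_trans by blast
      ultimately show "\<exists>n\<ge>1. (\<forall>m\<in>M ` E. n \<le> m) \<and> M ` E \<in> schreier \<phi> (osucc (\<phi> \<xi> n))"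
        using n(1) by blast
    qed
  qed
qed (simp add: schreier_omega1 spreading_def image_fin_sets)

lemma schreier_subset_osucc:
  assumes "osucc \<xi> < omega1"
  shows "schreier \<phi> \<xi> \<subseteq> schreier \<phi> (osucc \<xi>)"
proof
  fix E assume E: "E \<in> schreier \<phi> \<xi>"
  show "E \<in> schreier \<phi> (osucc \<xi>)"
  proof (cases "E = {}")
    case False
    have "E \<in> fin_sets" using E schreier_subset_fin_sets by blast
    then have "Min E \<in> E" "0 \<notin> E" using False by (simp_all add: fin_sets_def)
    then have "Min E \<noteq> 0" by metis
    then have "Min ` set [E] \<in> schreier_1" by (simp add: schreier_1_def fin_sets_def)
    then show ?thesis unfolding schreier_osucc[OF assms]
      by (intro family_compI[of _ "[E]"]) (use E False in auto)
  qed (simp add: empty_in_schreier)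
qed

text \<open>
  The families are not increasing in \<open>\<xi>\<close>, only up to finitely many points: at a limit, the condition
  \<open>n \<le> min E\<close> has to be met.
\<close>

lemma schreier_eventually_mono:
  assumes "\<xi> < omega1" "\<zeta> < \<xi>"
  shows "\<exists>n. \<forall>E\<in>schreier \<phi> \<zeta>. (\<forall>m\<in>E. n \<le> m) \<longrightarrow> E \<in> schreier \<phi> \<xi>"
  using assms
proof (induction rule: schreier_induct)
  case (succ \<xi>)
  show ?case
  proof (cases "\<zeta> = \<xi>")
    case True
    then show ?thesis using schreier_subset_osucc[OF succ.hyps] by blast
  next
    case False
    then have "\<zeta> < \<xi>" using succ.prems by (simp add: less_osucc_iff)
    then show ?thesis using succ.IH schreier_subset_osucc[OF succ.hyps] by blast
  qed
next
  case (limit \<xi>)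
  obtain k where k: "k \<ge> 1" "\<zeta> < \<phi> \<xi> k" using fundamental_cofinal[OF limit.hyps limit.prems] by blast
  then have "\<zeta> < osucc (\<phi> \<xi> k)" by (simp add: less_osucc_iff)
  then obtain n where "\<forall>E\<in>schreier \<phi> \<zeta>. (\<forall>m\<in>E. n \<le> m) \<longrightarrow> E \<in> schreier \<phi> (osucc (\<phi> \<xi> k))"
    using limit.IH[OF fundamental_less[OF limit.hyps k(1)]] by blast
  then show ?case using k(1)
    unfolding schreier_limit[OF limit.hyps] by (intro exI[of _ "max n k"]) auto
qed simp

text \<open>
  The proof is by induction on \<open>\<delta>\<close> with \<open>\<zeta>\<close> fixed. At a successor the union is grouped along the
  decomposition of the index set, and \<open>j \<le> h j\<close> keeps the minima of the groups far enough out for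
  them to form a set in \<open>\<S>\<^sub>1\<close>. At a limit, \<open>h\<close> has to dominate, on the indices from \<open>n\<close> on, both the
  function for the \<open>n\<close>-th approximating ordinal and the threshold at which the family for
  that ordinal enters the one of order \<open>\<zeta> + \<delta>\<close>; the index sets concerned have no smaller points.
\<close>

lemma schreier_absorbs:
  assumes "\<zeta> + \<delta> < omega1"
  shows "\<exists>h. (\<forall>j. j \<le> h j) \<and> absorbs (schreier \<phi> (\<zeta> + \<delta>)) (schreier \<phi> \<delta>) (schreier \<phi> \<zeta>) h"
  using assms
proof (induction \<delta> rule: ordinal_induct)
  case zero
  have "(\<Union>j\<in>A. s j) \<in> schreier \<phi> \<zeta>"
    if "A \<in> schreier \<phi> 0" "block_map (schreier \<phi> \<zeta>) h A s" for A s h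
  proof -
    have "finite A" "card A \<le> 1" using that(1) by (auto simp: schreier_0 fin_sets_def)
    then consider "A = {}" | j where "A = {j}" by (metis card_0_eq card_1_singletonE le_antisym less_one not_le)
    then show ?thesis using that(2) by cases (auto simp: empty_in_schreier block_map_def)
  qed
  then show ?case by (intro exI[of _ id]) (auto simp: absorbs_def)
next
  case (succ \<delta>)
  have less: "osucc (\<zeta> + \<delta>) < omega1" using succ.prems by (simp add: ordinal_add_osucc)
  then obtain h where h: "\<And>j. j \<le> h j"
    and abs: "absorbs (schreier \<phi> (\<zeta> + \<delta>)) (schreier \<phi> \<delta>) (schreier \<phi> \<zeta>) h"
    using succ.IH order_less_trans[OF osucc_greater] by blast
  have less': "osucc \<delta> < omega1"
    using ordinal_le_add_right[of "osucc \<delta>" \<zeta>] succ.prems by simp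
  have "(\<Union>j\<in>F. s j) \<in> schreier \<phi> (osucc (\<zeta> + \<delta>))"
    if F: "F \<in> schreier \<phi> (osucc \<delta>)" and s: "block_map (schreier \<phi> \<zeta>) h F s" for F s
  proof -
    from F have "F \<in> family_comp schreier_1 (schreier \<phi> \<delta>)" by (simp add: schreier_osucc[OF less'])
    then show ?thesis
    proof (cases rule: family_compE)
      case 1
      then show ?thesis by (simp add: empty_in_schreier)
    next
      case (2 Fs)
      have fin: "finite A" "A \<noteq> {}" "A \<subseteq> F" if "A \<in> set Fs" for A
        using 2 that schreier_subset_fin_sets by (auto simp: fin_sets_def)
      have sfin: "finite (s j)" "s j \<noteq> {}" if "j \<in> F" for j
        using s that schreier_subset_fin_sets by (auto simp: block_map_def fin_sets_def)
      have sep: "Max (s i) < Min (s j)" if "i \<in> F" "j \<in> F" "i < j" for i j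
        using s that by (simp add: block_map_def)
      have MinMax: "Min (s j) \<le> Max (s j)" if "j \<in> F" for j
        using sfin[OF that] by simp
      have Min: "Min (\<Union>j\<in>A. s j) = Min (s (Min A))" if A: "A \<in> set Fs" for A
      proof (rule Min_eqI)
        have MinA: "Min A \<in> A" using fin[OF A] by simp
        then show "Min (s (Min A)) \<in> (\<Union>j\<in>A. s j)" using sfin fin[OF A] by (meson Min_in UN_I subsetD)
        show "finite (\<Union>j\<in>A. s j)" using fin[OF A] sfin by blast
        fix b assume "b \<in> (\<Union>j\<in>A. s j)"
        then obtain j where j: "j \<in> A" "b \<in> s j" by blast
        then have "Min (s j) \<le> b" using sfin fin[OF A] by (meson Min_le subsetD)
        moreover have "Min (s (Min A)) \<le> Min (s j)"
        proof (cases "Min A = j")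
          case False
          then have "Min A < j" using Min_le[OF fin(1)[OF A] j(1)] by simp
          moreover have inF: "Min A \<in> F" "j \<in> F" using MinA j(1) fin(3)[OF A] by auto
          ultimately show ?thesis using sep[OF inF] MinMax[OF inF(1)] by linarith
        qed simp
        ultimately show "Min (s (Min A)) \<le> b" by simp
      qed
      have Max: "Max (\<Union>j\<in>A. s j) \<le> Max (s (Max A))" if A: "A \<in> set Fs" for A
      proof -
        have MaxA: "Max A \<in> A" using fin[OF A] by simp
        have "b \<le> Max (s (Max A))" if "b \<in> (\<Union>j\<in>A. s j)" for b
        proof -
          obtain j where j: "j \<in> A" "b \<in> s j" using \<open>b \<in> (\<Union>j\<in>A. s j)\<close> by blast
          then have "b \<le> Max (s j)" using sfin fin[OF A] by (meson Max_ge subsetD)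
          moreover have "Max (s j) \<le> Max (s (Max A))"
          proof (cases "j = Max A")
            case False
            then have "j < Max A" using Max_ge[OF fin(1)[OF A] j(1)] by simp
            moreover have inF: "j \<in> F" "Max A \<in> F" using MaxA j(1) fin(3)[OF A] by auto
            ultimately show ?thesis using sep[OF inF] MinMax[OF inF(2)] by linarith
          qed simp
          ultimately show ?thesis by simp
        qed
        moreover have "finite (\<Union>j\<in>A. s j)" "(\<Union>j\<in>A. s j) \<noteq> {}"
          using sfin subsetD[OF fin(3)[OF A]] MaxA by (auto intro!: finite_UN_I[OF fin(1)[OF A]])
        ultimately show ?thesis by simp
      qed
      define Es where "Es = map (\<lambda>A. \<Union>j\<in>A. s j) Fs"
      show ?thesis
        unfolding schreier_osucc[OF less]
      proof (rule family_compI[of _ Es])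
        show "(\<Union>j\<in>F. s j) = \<Union> (set Es)" by (auto simp: Es_def 2(1))
        show "A \<noteq> {} \<and> A \<in> schreier \<phi> (\<zeta> + \<delta>)" if "A \<in> set Es" for A
        proof -
          obtain B where B: "B \<in> set Fs" "A = (\<Union>j\<in>B. s j)"
            using \<open>A \<in> set Es\<close> by (auto simp: Es_def)
          have "block_map (schreier \<phi> \<zeta>) h B s"
            using s fin(3)[OF B(1)] unfolding block_map_def by blast
          then have "A \<in> schreier \<phi> (\<zeta> + \<delta>)" using abs 2(2)[OF B(1)] B(2) unfolding absorbs_def by blast
          moreover have "A \<noteq> {}"
            using B(2) fin(2)[OF B(1)] sfin(2) subsetD[OF fin(3)[OF B(1)]] by auto
          ultimately show ?thesis by blast
        qed
        show "Max (Es ! i) < Min (Es ! Suc i)" if "Suc i < length Es" for i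
        proof -
          have i: "Fs ! i \<in> set Fs" "Fs ! Suc i \<in> set Fs" using that by (auto simp: Es_def)
          have "Max (Es ! i) \<le> Max (s (Max (Fs ! i)))" using Max[OF i(1)] that by (simp add: Es_def)
          also have "\<dots> < Min (s (Min (Fs ! Suc i)))"
            using 2(3)[of i] that fin[OF i(1)] fin[OF i(2)]
            by (intro sep) (auto simp: Es_def dest: Max_in Min_in)
          also have "\<dots> = Min (Es ! Suc i)" using Min[OF i(2)] that by (simp add: Es_def)
          finally show ?thesis .
        qed
        have "Min ` set Es = (\<lambda>j. Min (s j)) ` Min ` set Fs" by (simp add: Es_def image_image Min)
        moreover have "n \<le> Min (s n)" if "n \<in> Min ` set Fs" for n
        proof -
          obtain A where A: "A \<in> set Fs" "n = Min A" using \<open>n \<in> Min ` set Fs\<close> by blast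
          then have "n \<in> F" using Min_in[OF fin(1,2)[OF A(1)]] fin(3)[OF A(1)] by auto
          then show ?thesis using s h[of n] by (auto simp: block_map_def intro: order_trans)
        qed
        ultimately show "Min ` set Es \<in> schreier_1" using schreier_1_image[OF 2(4)] by simp
      qed
    qed
  qed
  then show ?case using h by (auto simp: absorbs_def ordinal_add_osucc)
next
  case (limit \<delta>)
  have less': "\<delta> < omega1" using ordinal_le_add_right[of \<delta> \<zeta>] limit.prems by simp
  let ?\<delta> = "\<lambda>n. osucc (\<phi> \<delta> n)"
  have lt: "?\<delta> n < \<delta>" if "n \<ge> 1" for n by (rule fundamental_less[OF limit.hyps less' that])
  have lt': "\<zeta> + ?\<delta> n < \<zeta> + \<delta>" if "n \<ge> 1" for n by (rule ordinal_add_less_mono_right[OF lt[OF that]])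
  have "\<exists>h. n \<ge> 1 \<longrightarrow> absorbs (schreier \<phi> (\<zeta> + ?\<delta> n)) (schreier \<phi> (?\<delta> n)) (schreier \<phi> \<zeta>) h" for n
  proof (cases "n \<ge> 1")
    case True
    show ?thesis using limit.IH[OF lt[OF True] order_less_trans[OF lt'[OF True] limit.prems]] by blast
  qed simp
  then obtain h where h: "\<And>n. n \<ge> 1 \<Longrightarrow>
      absorbs (schreier \<phi> (\<zeta> + ?\<delta> n)) (schreier \<phi> (?\<delta> n)) (schreier \<phi> \<zeta>) (h n)" by metis
  have "\<exists>k. n \<ge> 1 \<longrightarrow> (\<forall>E\<in>schreier \<phi> (\<zeta> + ?\<delta> n). (\<forall>m\<in>E. k \<le> m) \<longrightarrow> E \<in> schreier \<phi> (\<zeta> + \<delta>))" for n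
  proof (cases "n \<ge> 1")
    case True
    show ?thesis using schreier_eventually_mono[OF limit.prems lt'[OF True]] by blast
  qed simp
  then obtain k where k: "\<And>n E. n \<ge> 1 \<Longrightarrow> E \<in> schreier \<phi> (\<zeta> + ?\<delta> n) \<Longrightarrow> \<forall>m\<in>E. k n \<le> m \<Longrightarrow>
      E \<in> schreier \<phi> (\<zeta> + \<delta>)" by metis
  define g where "g j = j + (\<Sum>n\<le>j. h n j + k n)" for j
  have g: "h n j \<le> g j" "k n \<le> g j" if "n \<le> j" for n j
  proof -
    have "h n j + k n \<le> (\<Sum>n\<le>j. h n j + k n)"
      using that by (intro member_le_sum[of n "{..j}" "\<lambda>n. h n j + k n"]) auto
    then show "h n j \<le> g j" "k n \<le> g j" by (simp_all add: g_def)
  qed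
  have "(\<Union>j\<in>F. s j) \<in> schreier \<phi> (\<zeta> + \<delta>)"
    if F: "F \<in> schreier \<phi> \<delta>" and s: "block_map (schreier \<phi> \<zeta>) g F s" for F s
  proof -
    obtain n where n: "n \<ge> 1" "\<forall>m\<in>F. n \<le> m" "F \<in> schreier \<phi> (?\<delta> n)"
      using F unfolding schreier_limit[OF limit.hyps less'] by blast
    have "block_map (schreier \<phi> \<zeta>) (h n) F s"
      using s g(1) n(2) unfolding block_map_def by (meson order_trans)
    then have "(\<Union>j\<in>F. s j) \<in> schreier \<phi> (\<zeta> + ?\<delta> n)" using h[OF n(1)] n(3) unfolding absorbs_def by blast
    moreover have "k n \<le> m" if m: "m \<in> (\<Union>j\<in>F. s j)" for m
    proof -
      obtain j where j: "j \<in> F" "m \<in> s j" using m by blast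
      then have "finite (s j)" using s schreier_subset_fin_sets by (auto simp: block_map_def fin_sets_def)
      then have "Min (s j) \<le> m" using j(2) by simp
      moreover have "g j \<le> Min (s j)" using s j(1) by (simp add: block_map_def)
      ultimately show ?thesis using g(2)[of n j] n(2) j(1) by force
    qed
    ultimately show ?thesis using k[OF n(1)] by blast
  qed
  moreover have "j \<le> g j" for j by (simp add: g_def)
  ultimately show ?case unfolding absorbs_def by blast
qed

lemma self_absorbing_fin_sets: "self_absorbing fin_sets"
  unfolding self_absorbing_def
proof (intro conjI exI[of _ "\<lambda>_. fin_sets"] allI impI ballI)
  show "spreading fin_sets" by (simp add: spreading_def image_fin_sets)
  show "\<exists>h. absorbs fin_sets fin_sets fin_sets h"
    by (intro exI[of _ id]) (auto simp: absorbs_def block_map_def fin_sets_def)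
  show "\<exists>k\<ge>1. (\<forall>m\<in>E. k \<le> m) \<and> E \<in> fin_sets" if "E \<in> fin_sets" for E
    using that by (intro exI[of _ 1]) (auto simp: fin_sets_def Suc_le_eq intro: gr0I)
qed simp_all

text \<open>
  The order \<open>1 = \<omega>^0\<close> is the one power of \<open>\<omega>\<close> that is not a limit; sets of at most \<open>k\<close> points take the
  place of the approximating families. With \<open>h j = k j\<close>, a union over \<open>F\<close> has at most \<open>k |F|\<close> points
  and starts no earlier than \<open>k (min F)\<close>.
\<close>

lemma self_absorbing_schreier_1: "self_absorbing schreier_1"
  unfolding self_absorbing_def
proof (intro conjI exI[of _ "\<lambda>k. {E\<in>fin_sets. card E \<le> k}"] allI impI ballI)
  show "schreier_1 \<subseteq> fin_sets" by (auto simp: schreier_1_def)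
  fix k :: nat
  show "spreading {E\<in>fin_sets. card E \<le> k}"
    unfolding spreading_def
  proof (intro ballI allI impI CollectI)
    fix E and M :: "nat \<Rightarrow> nat" assume E: "E \<in> {E\<in>fin_sets. card E \<le> k}" and M: "strict_mono M"
    then have "finite E" by (simp add: fin_sets_def)
    from card_image_le[OF this, of M] show "M ` E \<in> fin_sets \<and> card (M ` E) \<le> k"
      using E image_fin_sets[OF _ M] by auto
  qed
  have "(\<Union>j\<in>F. s j) \<in> schreier_1"
    if F: "F \<in> schreier_1" and s: "block_map {E\<in>fin_sets. card E \<le> k} (\<lambda>j. k * j) F s" for F s
  proof (cases "F = {}")
    case False
    have fin: "finite F" "card F \<le> Min F" using F False by (auto simp: schreier_1_def fin_sets_def)
    have sj: "s j \<in> fin_sets" "card (s j) \<le> k" "s j \<noteq> {}" "k * j \<le> Min (s j)" if "j \<in> F" for j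
      using s that by (auto simp: block_map_def)
    let ?U = "\<Union>j\<in>F. s j"
    have U: "?U \<in> fin_sets" using sj(1) fin(1) by (auto simp: fin_sets_def)
    have "card ?U \<le> (\<Sum>j\<in>F. card (s j))" by (rule card_UN_le[OF fin(1)])
    also have "\<dots> \<le> (\<Sum>j\<in>F. k)" by (intro sum_mono sj(2))
    also have "\<dots> = k * card F" by simp
    finally have card: "card ?U \<le> k * card F" .
    have "k * card F \<le> m" if m: "m \<in> ?U" for m
    proof -
      obtain j where j: "j \<in> F" "m \<in> s j" using m by blast
      have "k * card F \<le> k * j" using fin Min_le[OF fin(1) j(1)] by simp
      also have "\<dots> \<le> Min (s j)" by (rule sj(4)[OF j(1)])
      also have "\<dots> \<le> m" using sj(1)[OF j(1)] j(2) by (simp add: fin_sets_def)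
      finally show ?thesis .
    qed
    moreover have "?U \<noteq> {}" using False sj(3) by blast
    ultimately have "k * card F \<le> Min ?U" using U by (simp add: fin_sets_def)
    then show ?thesis using U card by (simp add: schreier_1_def)
  qed (simp add: schreier_1_def fin_sets_def)
  then show "\<exists>h. absorbs schreier_1 schreier_1 {E\<in>fin_sets. card E \<le> k} h"
    unfolding absorbs_def by blast
next
  fix E assume E: "E \<in> schreier_1"
  show "\<exists>k\<ge>1. (\<forall>m\<in>E. k \<le> m) \<and> E \<in> {E\<in>fin_sets. card E \<le> k}"
  proof (cases "E = {}")
    case False
    then have "finite E" "card E \<le> Min E" "E \<in> fin_sets" using E by (auto simp: schreier_1_def fin_sets_def)
    then show ?thesis using False
      by (intro exI[of _ "card E"]) (auto simp: Suc_le_eq card_gt_0_iff intro: order_trans)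
  qed (auto simp: fin_sets_def)
qed auto

text \<open>
  For a limit \<open>\<alpha> = \<omega>^\<xi>\<close> the approximating ordinals \<open>\<zeta> < \<alpha>\<close> satisfy \<open>\<zeta> + \<alpha> = \<alpha>\<close>.
\<close>

lemma self_absorbing_schreier_omega_pow:
  assumes less: "omega_pow \<xi> < (omega1 :: 'u ordinal)"
  shows "self_absorbing (schreier \<phi> (omega_pow \<xi>))"
proof (cases "\<xi> = 0")
  case True
  have "osucc 0 < (omega1 :: 'u ordinal)" using less True by (simp add: one_ordinal_def)
  then have "schreier \<phi> (omega_pow \<xi>) = schreier_1"
    by (simp only: True omega_pow_0 one_ordinal_def schreier_osucc schreier_0 family_comp_singletons)
  then show ?thesis using self_absorbing_schreier_1 by simp
next
  case False
  then have "0 < \<xi>" by (metis ordinal_zero_le order_le_less)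
  let ?\<alpha> = "omega_pow \<xi>"
  have lim: "limit_ordinal ?\<alpha>" by (rule limit_ordinal_omega_pow[OF \<open>0 < \<xi>\<close>])
  show ?thesis
    unfolding self_absorbing_def
  proof (intro conjI exI[of _ "\<lambda>k. schreier \<phi> (osucc (\<phi> ?\<alpha> k))"] allI impI ballI)
    fix k :: nat assume k: "1 \<le> k"
    have "osucc (\<phi> ?\<alpha> k) + ?\<alpha> = ?\<alpha>"
      by (rule add_omega_pow_absorb[OF fundamental_less[OF lim less k] \<open>0 < \<xi>\<close>])
    then show "\<exists>h. absorbs (schreier \<phi> ?\<alpha>) (schreier \<phi> ?\<alpha>) (schreier \<phi> (osucc (\<phi> ?\<alpha> k))) h"
      using schreier_absorbs[of "osucc (\<phi> ?\<alpha> k)" ?\<alpha>] less by auto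
  next
    show "\<exists>k\<ge>1. (\<forall>m\<in>E. k \<le> m) \<and> E \<in> schreier \<phi> (osucc (\<phi> ?\<alpha> k))" if "E \<in> schreier \<phi> ?\<alpha>" for E
      using that unfolding schreier_limit[OF lim less] by blast
  qed (use schreier_subset_fin_sets in \<open>auto simp: spreading_schreier\<close>)
qed

text \<open>
  A spreading model of order \<open>\<alpha>\<close> contains one of every smaller order, after dropping finitely many
  terms, so that the minimum in the definition of the index need not be considered. Above \<open>\<omega>\<^sub>1\<close>
  the families are constant, and an \<open>\<alpha> \<ge> \<omega>\<^sub>1\<close> is exceeded exactly when the index is \<open>\<infinity>\<close>.
\<close>

lemma less_SM_iff:
  "Fin \<alpha> < SM \<phi> p TYPE('x::banach) K \<longleftrightarrow> spread_in (schreier \<phi> \<alpha>) (Tp p K :: 'x list set)"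
proof -
  have spread: "(\<exists>x :: nat \<Rightarrow> 'x. spreading_model \<phi> p K \<zeta> x) \<longleftrightarrow> spread_in (schreier \<phi> \<zeta>) (Tp p K :: 'x list set)"
    for \<zeta> by (simp add: spreading_model_def spread_in_def)
  let ?N = "{\<zeta>. \<zeta> \<le> omega1 \<and> \<not> spread_in (schreier \<phi> \<zeta>) (Tp p K :: 'x list set)}"
  have "Fin \<alpha> < SM \<phi> p TYPE('x) K \<longleftrightarrow> (\<forall>\<zeta>\<in>?N. \<alpha> < \<zeta>)"
  proof (cases "?N = {}")
    case True
    then have "\<forall>\<zeta>\<in>?N. \<alpha> < \<zeta>" by blast
    then show ?thesis unfolding SM_def spread Let_def True by (simp add: less_extended_def)
  next
    case False
    then obtain \<zeta> where "\<zeta> \<in> ?N" by blast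
    then have least: "(LEAST \<zeta>. \<zeta> \<in> ?N) \<in> ?N" by (rule LeastI[of "\<lambda>\<zeta>. \<zeta> \<in> ?N"])
    have "\<alpha> < (LEAST \<zeta>. \<zeta> \<in> ?N) \<longleftrightarrow> (\<forall>\<zeta>\<in>?N. \<alpha> < \<zeta>)"
    proof
      show "\<forall>\<zeta>\<in>?N. \<alpha> < \<zeta>" if "\<alpha> < (LEAST \<zeta>. \<zeta> \<in> ?N)"
        by (rule ballI) (rule order_less_le_trans[OF that Least_le[of "\<lambda>\<zeta>. \<zeta> \<in> ?N"]])
      show "\<alpha> < (LEAST \<zeta>. \<zeta> \<in> ?N)" if "\<forall>\<zeta>\<in>?N. \<alpha> < \<zeta>"
        by (rule bspec[OF that least])
    qed
    then show ?thesis unfolding SM_def spread Let_def using False by simp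
  qed
  also have "\<dots> \<longleftrightarrow> spread_in (schreier \<phi> \<alpha>) (Tp p K :: 'x list set)"
  proof
    assume N: "\<forall>\<zeta>\<in>?N. \<alpha> < \<zeta>"
    have "min \<alpha> omega1 \<notin> ?N"
    proof
      assume "min \<alpha> omega1 \<in> ?N"
      then have "\<alpha> < min \<alpha> omega1" using N by blast
      then show False by simp
    qed
    then have "spread_in (schreier \<phi> (min \<alpha> omega1)) (Tp p K :: 'x list set)" by simp
    moreover have "schreier \<phi> (min \<alpha> omega1) = schreier \<phi> \<alpha>"
      using schreier_omega1[of \<alpha>] schreier_omega1[of omega1] by (cases "\<alpha> \<le> omega1") (simp_all add: min_def)
    ultimately show "spread_in (schreier \<phi> \<alpha>) (Tp p K :: 'x list set)" by simp
  next
    assume spread: "spread_in (schreier \<phi> \<alpha>) (Tp p K :: 'x list set)"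
    have "spread_in (schreier \<phi> \<zeta>) (Tp p K :: 'x list set)" if "\<zeta> \<le> \<alpha>" for \<zeta>
    proof -
      have "\<exists>n. \<forall>E\<in>schreier \<phi> \<zeta>. (\<forall>m\<in>E. n \<le> m) \<longrightarrow> E \<in> schreier \<phi> \<alpha>"
      proof (cases "\<alpha> < omega1")
        case True
        then show ?thesis using schreier_eventually_mono[OF True] that by (auto simp: order_le_less)
      next
        case False
        then show ?thesis using schreier_subset_fin_sets by (auto simp: schreier_omega1)
      qed
      then show ?thesis
        using spread_in_mono_tail[OF spread spreading_schreier schreier_subset_fin_sets] by blast
    qed
    then show "\<forall>\<zeta>\<in>?N. \<alpha> < \<zeta>" by (auto simp: not_le[symmetric])
  qed
  finally show ?thesis .
qed

lemma self_absorbing_schreier: "self_absorbing (schreier \<phi> (omega_pow \<xi>))"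
  using self_absorbing_schreier_omega_pow self_absorbing_fin_sets schreier_omega1 not_le by metis

end

section \<open>The equality of the classes\<close>

lemma some_iff_all:
  fixes P :: "real \<Rightarrow> bool"
  assumes "\<And>K K'. 1 < K \<Longrightarrow> 1 < K' \<Longrightarrow> P K \<Longrightarrow> P K'"
  shows "(\<exists>K>1. P K) \<longleftrightarrow> (\<forall>K>1. P K)"
  using assms by (meson gt_ex)

theorem corollary6p3:
  fixes \<xi> :: "'u ordinal" and p :: ereal
  assumes "p \<in> {1, \<infinity>}"
  shows "(P1_some (omega_pow \<xi>) p TYPE('x::banach) \<longleftrightarrow> P1_all (omega_pow \<xi>) p TYPE('x)) \<and>
    (P2_some (omega_pow \<xi>) p :: (nat \<Rightarrow> 'x set) set) = P2_all (omega_pow \<xi>) p \<and>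
    (P3_some (omega_pow \<xi>) p :: (nat \<Rightarrow> 'x set) set) = P3_all (omega_pow \<xi>) p \<and>
    (\<forall>\<phi>. fundamental_system \<phi> \<longrightarrow>
      (P4_some \<phi> (omega_pow \<xi>) p TYPE('x) \<longleftrightarrow> P4_all \<phi> (omega_pow \<xi>) p TYPE('x)))"
proof (intro conjI allI impI)
  have improve: "(\<exists>K>1. L (Tp p K)) \<longleftrightarrow> (\<forall>K>1. L (Tp p K))" if "stable_largeness L"
    for L :: "'x list set \<Rightarrow> bool"
    by (rule some_iff_all) (rule Tp_distortion[OF that assms])
  have closed: "subseq_closed (Tp p K :: 'x list set)" for K by (rule subseq_closed_Tp[OF assms])

  have "index_p p TYPE('x) K > Fin (omega_pow (omega_pow \<xi>)) \<longleftrightarrow>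
      iter_deriv (tail_deriv (\<lambda>_. UNIV)) (Tp p K \<inter> UNIV :: 'x list set) (omega_pow (omega_pow \<xi>)) \<noteq> {}" for K
    unfolding index_p_def by (simp only: less_tree_order_iff[OF closed] Int_UNIV_right)
  then show "P1_some (omega_pow \<xi>) p TYPE('x) \<longleftrightarrow> P1_all (omega_pow \<xi>) p TYPE('x)"
    unfolding P1_some_def P1_all_def
    using improve[OF block_class.stable_largeness_der[OF block_class_UNIV]] by (simp only:)

  have "(\<exists>K>1. block_index_p p E K > Fin (omega_pow (omega_pow \<xi>))) \<longleftrightarrow>
      (\<forall>K>1. block_index_p p E K > Fin (omega_pow (omega_pow \<xi>)))"
    if E: "FDD E" for E :: "nat \<Rightarrow> 'x set"
  proof -
    note block = block_class_block_sequences_UNIV[OF E]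
    have "block_index_p p E K > Fin (omega_pow (omega_pow \<xi>)) \<longleftrightarrow>
      iter_deriv (tail_deriv (\<lambda>_. UNIV)) (Tp p K \<inter> block_sequences E) (omega_pow (omega_pow \<xi>)) \<noteq> {}" for K
      unfolding block_index_p_def Tp_block_def
      by (intro less_tree_order_iff subseq_closed_Int closed block_class.closed[OF block])
    then show ?thesis using improve[OF block_class.stable_largeness_der[OF block]] by (simp only:)
  qed
  then show "P2_some (omega_pow \<xi>) p = (P2_all (omega_pow \<xi>) p :: (nat \<Rightarrow> 'x set) set)"
    unfolding P2_some_def P2_all_def by blast

  have "(\<exists>K>1. asymp_index_p p E K > Fin (omega_pow (omega_pow \<xi>))) \<longleftrightarrow>
      (\<forall>K>1. asymp_index_p p E K > Fin (omega_pow (omega_pow \<xi>)))"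
    if E: "FDD E" for E :: "nat \<Rightarrow> 'x set"
  proof -
    have "asymp_index_p p E K > Fin (omega_pow (omega_pow \<xi>)) \<longleftrightarrow>
      iter_deriv (tail_deriv (\<lambda>i. {y. \<forall>j\<in>supp E y. i \<le> j})) (Tp p K \<inter> block_sequences E)
        (omega_pow (omega_pow \<xi>)) \<noteq> {}" for K
      unfolding asymp_index_p_def Tp_block_def FDD_deriv_eq_tail_deriv
      by (rule less_deriv_order_iff[OF tail_deriv_subset])
    then show ?thesis
      using improve[OF block_class.stable_largeness_der[OF block_class_block_sequences[OF E]]]
      by (simp only:)
  qed
  then show "P3_some (omega_pow \<xi>) p = (P3_all (omega_pow \<xi>) p :: (nat \<Rightarrow> 'x set) set)"
    unfolding P3_some_def P3_all_def by blast

  fix \<phi> :: "'u ordinal \<Rightarrow> nat \<Rightarrow> 'u ordinal"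
  assume \<phi>: "fundamental_system \<phi>"
  show "P4_some \<phi> (omega_pow \<xi>) p TYPE('x) \<longleftrightarrow> P4_all \<phi> (omega_pow \<xi>) p TYPE('x)"
    unfolding P4_some_def P4_all_def less_SM_iff[OF \<phi>]
    by (rule improve[OF stable_largeness_spread_in[OF self_absorbing_schreier[OF \<phi>]]])
qed

end
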